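(* The following two assertions are equivalent. (K) For all positive-definite ternary quadratic forms $f,g$ with real coefficients such that $f\notin \mathbb{R}^\times\,\mathrm{Sym}^2(\mathbb{Q}^3)^*$, $f\not\sim g$ and $q_{\mathbb Z}(f)=q_{\mathbb Z}(g)$, there are $c,d\in\mathbb{R}$ such that one of the following holds: (i) $\{f,g\}\sim\{c(x_1^2-x_1x_2+x_2^2)+dx_3^2,\ c(x_1^2+3x_2^2)+dx_3^2\}$; (ii) $\{f,g\}\sim\{c(x_1^2-x_1x_2+x_2^2)+d(x_1+x_2+3x_3)^2,\ c(x_1^2+3x_2^2)+d(x_1+3x_3)^2\}$. ( * ) Whenever $(A_1,B_1),(A_2,B_2)\in \mathrm{Sym}^2(\mathbb{Q}^3)^*\otimes_{\mathbb Q}\mathbb{Q}^2$ satisfy, for both $i=1,2$, (a) $A_i$ and $B_i$ are linearly independent over $\mathbb{Q}$, (b) $cA_i+dB_i$ is positive-definite for some $c,d\in\mathbb{Q}$, and (c) $q_{\mathbb Z}(A_1,B_1)=q_{\mathbb Z}(A_2,B_2)$, then either $(A_1,B_1)=(w,1)\cdot(A_2,B_2)$ for some $w\in GL_3(\mathbb{Z})$, or there are $w_1,w_2\in GL_3(\mathbb{Z})$ and $v\in GL_2(\mathbb{Q})$ such that the set $\{(A_1,B_1),(A_2,B_2)\}$ equals one of (i) $\{(w_1,v)\cdot(x_1^2-x_1x_2+x_2^2,\ x_3^2),\ (w_2,v)\cdot(x_1^2+3x_2^2,\ x_3^2)\}$, (ii) $\{(w_1,v)\cdot(x_1^2-x_1x_2+x_2^2,\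 (x_1+x_2+3x_3)^2),\ (w_2,v)\cdot(x_1^2+3x_2^2,\ (x_1+3x_3)^2)\}$.
   Context: For a field $k$ of characteristic $\neq2$, $\mathrm{Sym}^2(k^n)^*$ is the set of $n$-ary quadratic forms over $k$, and $\mathrm{Sym}^2(k^n)^*\otimes_k k^2$ is the set of pairs $(A,B)$ of such forms. For a subring $R\subset k$ and forms $f_1,\dots,f_s$, $q_R(f_1,\dots,f_s)=\{(f_1(v),\dots,f_s(v)) : 0\neq v\in R^n\}$; in particular $q_{\mathbb Z}(f)=\{f(v):0\ne v\in\mathbb{Z}^3\}$. For real ternary forms, $f\sim g$ means $f(\mathbf{x}w)=g(\mathbf{x})$ for some $w\in GL_3(\mathbb{Z})$ ($\mathbf{x}$ is a row vector). $\{f,g\}\sim\{f_2,g_2\}$ means that either ($f\sim f_2$ and $g\sim g_2$) or ($f\sim g_2$ and $g\sim f_2$). $\mathbb{R}^\times\,\mathrm{Sym}^2(\mathbb{Q}^3)^*$ is the set of real nonzero multiples of forms with rational coefficients. The group $GL_3(\mathbb{Q})\times GL_2(\mathbb{Q})$ acts on pairs by $$\left(w,\begin{pmatrix} r&s\\t&u\end{pmatrix}\right)\cdot(A,B)=(rA(\mathbf{x}w)+sB(\mathbf{x}w),\ tA(\mathbf{x}w)+uB(\mathbf{x}w)).$$ *)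

theory Defs
  imports "HOL-Analysis.Analysis"
begin

(* Forms are represented by the functions they induce, which loses nothing over the
   infinite fields rat and real.  The matrix of coefficients is not required to be
   symmetric, so that quad_forms R consists of the quadratic polynomials with all
   coefficients in R; with UNIV for R this is Sym^2(k^n)^*, and with \<rat> for R it is
   the image of Sym^2(Q^n)^* over a field k of characteristic 0. *)
definition quad_forms :: "'a set \<Rightarrow> ('a::field ^ 'n \<Rightarrow> 'a) set" where
  "quad_forms R = {f. \<exists>M :: 'a ^ 'n ^ 'n. (\<forall>i j. M $ i $ j \<in> R) \<and>
     f = (\<lambda>x. \<Sum>i\<in>UNIV. \<Sum>j\<in>UNIV. M $ i $ j * x $ i * x $ j)}"

definition pos_definite :: "('a::linordered_field ^ 'n \<Rightarrow> 'a) \<Rightarrow> bool" where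
  "pos_definite f \<longleftrightarrow> (\<forall>x. x \<noteq> 0 \<longrightarrow> f x > 0)"

(* q_R(f_1,...,f_s) is value_set R F for the tuple-valued function F = (f_1,...,f_s). *)
definition value_set :: "'a set \<Rightarrow> ('a::zero ^ 'n \<Rightarrow> 'b) \<Rightarrow> 'b set" where
  "value_set R F = {F v | v. v \<noteq> 0 \<and> (\<forall>i. v $ i \<in> R)}"

(* GL_n(Z), embedded in the matrices over a ring of characteristic 0; invertibility is
   required over int. *)
definition GL_int :: "('a::ring_char_0 ^ 'n ^ 'n) set" where
  "GL_int = {map_matrix of_int w | w :: int ^ 'n ^ 'n. invertible w}"

definition form_equiv :: "(real ^ 3 \<Rightarrow> real) \<Rightarrow> (real ^ 3 \<Rightarrow> real) \<Rightarrow> bool" where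
  "form_equiv f g \<longleftrightarrow> (\<exists>w\<in>GL_int. \<forall>x. f (x v* w) = g x)"

definition unordered_pair_equiv ::
  "(real ^ 3 \<Rightarrow> real) \<Rightarrow> (real ^ 3 \<Rightarrow> real) \<Rightarrow>
   (real ^ 3 \<Rightarrow> real) \<Rightarrow> (real ^ 3 \<Rightarrow> real) \<Rightarrow> bool" where
  "unordered_pair_equiv f g f' g' \<longleftrightarrow>
     (form_equiv f f' \<and> form_equiv g g') \<or> (form_equiv f g' \<and> form_equiv g f')"

definition lin_indep_forms ::
  "('a::field ^ 'n \<Rightarrow> 'a) \<Rightarrow> ('a ^ 'n \<Rightarrow> 'a) \<Rightarrow> bool" where
  "lin_indep_forms A B \<longleftrightarrow>
     (\<forall>a b. (\<forall>x. a * A x + b * B x = 0) \<longrightarrow> a = 0 \<and> b = 0)"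

fun pair_act :: "'a::field ^ 3 ^ 3 \<Rightarrow> 'a ^ 2 ^ 2 \<Rightarrow>
    ('a ^ 3 \<Rightarrow> 'a) \<times> ('a ^ 3 \<Rightarrow> 'a) \<Rightarrow> ('a ^ 3 \<Rightarrow> 'a) \<times> ('a ^ 3 \<Rightarrow> 'a)" where
  "pair_act w v (A, B) =
     (\<lambda>x. v $ 1 $ 1 * A (x v* w) + v $ 1 $ 2 * B (x v* w),
      \<lambda>x. v $ 2 $ 1 * A (x v* w) + v $ 2 $ 2 * B (x v* w))"

end

theory Submission
  imports Defs
begin

text \<open>
  A real form \<open>f\<close> whose coefficients span a two-dimensional space over the rationals amounts to a
  pair of rational forms: writing \<open>f = \<alpha> A + \<beta> B\<close> with \<open>\<alpha>\<close> and \<open>\<beta>\<close>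
  independent over the rationals, the value of \<open>f\<close> at an integer vector determines the values of
  \<open>A\<close> and \<open>B\<close>. Under this dictionary equality of value sets, integral equivalence and the two
  exceptional families correspond to each other.

  Passing from real forms to pairs (\<open>real_to_rational\<close>) is immediate, once a suitable
  combination of a given pair is known to be positive definite. This holds because definiteness is open
  (\<open>eventually_pos_definite\<close>) and passes from the rationals to the reals
  (\<open>pos_definite_real_extension\<close>).

  In the other direction (\<open>rational_to_real\<close>) the coefficients of \<open>f\<close> may span a larger space. Composing
  \<open>f\<close> and \<open>g\<close> with rational linear functionals on the reals gives many pairs of rational forms to which the
  rational assertion applies, but the transformations it provides depend on the functionals. Two facts
  make them uniform. When one functional sends \<open>f\<close> to a definite form and is kept fixed, only
  finitely many integral transformations can occur (\<open>finite_isometries\<close>,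
  \<open>finite_pencil_isometries\<close>); and each of them serves a linear subspace of functionals, while a
  vector space over the rationals is not a finite union of proper subspaces
  (\<open>finite_cover_lin_closed\<close>). Hence one transformation serves all functionals. Since functionals
  separate real numbers (\<open>rat_linear_separate\<close>), it serves \<open>f\<close> and \<open>g\<close>.
\<close>

section \<open>Ternary forms and integer vectors\<close>

definition int_vec :: "int ^ 3 \<Rightarrow> 'a::ring_1 ^ 3" where
  "int_vec u = (\<chi> i. of_int (u $ i))"

lemma int_vec_nth [simp]: "int_vec u $ i = of_int (u $ i)"
  by (simp add: int_vec_def)

lemma int_vec_eq_0_iff [simp]: "(int_vec u :: 'a::ring_char_0 ^ 3) = 0 \<longleftrightarrow> u = 0"
  by (simp add: vec_eq_iff)

lemma int_vec_0 [simp]: "int_vec 0 = 0"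
  by (simp add: vec_eq_iff)

lemma int_vec_mult: "int_vec u v* map_matrix of_int w = int_vec (u v* w)"
  for u :: "int ^ 3" and w :: "int ^ 3 ^ 3"
  by (simp add: vec_eq_iff vector_matrix_mult_def map_matrix_def)

lemma value_set_Ints:
  "value_set \<int> F = {F (int_vec u) | u. u \<noteq> 0}" for F :: "'a::ring_char_0 ^ 3 \<Rightarrow> 'b"
proof -
  have "\<exists>u. v = int_vec u" if "\<forall>i. v $ i \<in> \<int>" for v :: "'a ^ 3"
  proof -
    have "\<forall>i. \<exists>n. v $ i = of_int n" using that by (meson Ints_cases)
    then obtain c where "\<forall>i. v $ i = of_int (c i)" by (rule choice[THEN exE])
    then have "v = int_vec (\<chi> i. c i)" by (simp add: vec_eq_iff)
    then show ?thesis ..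
  qed
  moreover have "\<forall>i. (int_vec u :: 'a ^ 3) $ i \<in> \<int>" for u by simp
  ultimately show ?thesis
    unfolding value_set_def using int_vec_eq_0_iff by blast
qed

text \<open>A ternary form is determined by its values at the three unit vectors and at their pairwise sums.
  Hence identities between forms only have to be checked at integer vectors, and this is how forms
  over the rationals and over the reals are compared throughout.\<close>

abbreviation pt :: "int \<Rightarrow> int \<Rightarrow> int \<Rightarrow> 'a::ring_1 ^ 3" where
  "pt a b c \<equiv> int_vec (vector [a, b, c])"

lemma quad_formI:
  fixes f :: "'a::field ^ 3 \<Rightarrow> 'a"
  assumes "a \<in> R" "b \<in> R" "c \<in> R" "d \<in> R" "e \<in> R" "h \<in> R" "0 \<in> R"
    and "\<And>x. f x = a * (x$1)\<^sup>2 + b * (x$2)\<^sup>2 + c * (x$3)\<^sup>2 + d * x$1 * x$2 + e * x$1 * x$3 + h * x$2 * x$3"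
  shows "f \<in> quad_forms R"
proof -
  let ?M = "vector [vector [a, d, e], vector [0, b, h], vector [0, 0, c]] :: 'a ^ 3 ^ 3"
  have "f = (\<lambda>x. \<Sum>i\<in>UNIV. \<Sum>j\<in>UNIV. ?M $ i $ j * x $ i * x $ j)"
    by (rule ext) (simp add: assms(8) sum_3 power2_eq_square algebra_simps)
  moreover have "\<forall>i j. ?M $ i $ j \<in> R"
    using assms(1-7) by (simp add: forall_3)
  ultimately show ?thesis unfolding quad_forms_def by blast
qed

lemma quad_form_expand:
  fixes f :: "'a::field ^ 3 \<Rightarrow> 'a"
  assumes "f \<in> quad_forms UNIV"
  shows "f x = f (pt 1 0 0) * (x$1)\<^sup>2 + f (pt 0 1 0) * (x$2)\<^sup>2 + f (pt 0 0 1) * (x$3)\<^sup>2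
      + (f (pt 1 1 0) - f (pt 1 0 0) - f (pt 0 1 0)) * x$1 * x$2
      + (f (pt 1 0 1) - f (pt 1 0 0) - f (pt 0 0 1)) * x$1 * x$3
      + (f (pt 0 1 1) - f (pt 0 1 0) - f (pt 0 0 1)) * x$2 * x$3"
proof -
  from assms obtain M where "f = (\<lambda>x. \<Sum>i\<in>UNIV. \<Sum>j\<in>UNIV. M $ i $ j * x $ i * x $ j)"
    unfolding quad_forms_def by auto
  then show ?thesis by (simp add: sum_3 algebra_simps power2_eq_square)
qed

lemma quad_forms_eqI:
  fixes f :: "'a::field ^ 3 \<Rightarrow> 'a"
  assumes "f \<in> quad_forms UNIV" "g \<in> quad_forms UNIV" "\<And>u. f (int_vec u) = g (int_vec u)"
  shows "f = g"
proof
  fix x show "f x = g x"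
    by (subst quad_form_expand[OF assms(1)], subst quad_form_expand[OF assms(2)]) (simp only: assms(3))
qed

lemma quad_form_scale:
  fixes f :: "'a::field ^ 3 \<Rightarrow> 'a"
  assumes "f \<in> quad_forms UNIV"
  shows "f (t *s x) = t\<^sup>2 * f x"
  using assms unfolding quad_forms_def by (auto simp: sum_distrib_left algebra_simps power2_eq_square)

lemma quad_form_0: "f \<in> quad_forms UNIV \<Longrightarrow> f 0 = 0"
  unfolding quad_forms_def by auto

lemma quad_forms_lincomb:
  assumes "f \<in> quad_forms UNIV" "g \<in> quad_forms UNIV"
  shows "(\<lambda>x. a * f x + b * g x) \<in> quad_forms UNIV"
proof -
  from assms obtain M N where
    "f = (\<lambda>x. \<Sum>i\<in>UNIV. \<Sum>j\<in>UNIV. M $ i $ j * x $ i * x $ j)"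
    "g = (\<lambda>x. \<Sum>i\<in>UNIV. \<Sum>j\<in>UNIV. N $ i $ j * x $ i * x $ j)" unfolding quad_forms_def by auto
  then have "(\<lambda>x. a * f x + b * g x) =
      (\<lambda>x. \<Sum>i\<in>UNIV. \<Sum>j\<in>UNIV. (\<chi> i j. a * M$i$j + b * N$i$j) $ i $ j * x $ i * x $ j)"
    by (simp add: sum_distrib_left sum.distrib algebra_simps)
  then show ?thesis unfolding quad_forms_def by blast
qed

lemma quad_forms_compose:
  fixes f :: "'a::field ^ 3 \<Rightarrow> 'a"
  assumes "f \<in> quad_forms UNIV"
  shows "(\<lambda>x. f (x v* w)) \<in> quad_forms UNIV"
proof -
  from assms obtain M where M: "f = (\<lambda>x. \<Sum>i\<in>UNIV. \<Sum>j\<in>UNIV. M $ i $ j * x $ i * x $ j)"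
    unfolding quad_forms_def by auto
  let ?N = "w ** M ** transpose w"
  have "f (x v* w) = (\<Sum>i\<in>UNIV. \<Sum>j\<in>UNIV. ?N $ i $ j * x $ i * x $ j)" for x
  proof -
    have "f (x v* w) = (\<Sum>k\<in>UNIV. \<Sum>l\<in>UNIV. \<Sum>i\<in>UNIV. \<Sum>j\<in>UNIV. M$k$l * (x$i * w$i$k) * (x$j * w$j$l))"
      unfolding M vector_matrix_mult_def vec_lambda_beta mult.assoc[of "M $ k $ l" for k l]
      by (simp only: sum_product) (simp add: sum_distrib_left mult_ac)
    also have "\<dots> = (\<Sum>i\<in>UNIV. \<Sum>j\<in>UNIV. \<Sum>l\<in>UNIV. \<Sum>k\<in>UNIV. M$k$l * (x$i * w$i$k) * (x$j * w$j$l))"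
      by (simp add: sum_3 sum.distrib algebra_simps)
    also have "\<dots> = (\<Sum>i\<in>UNIV. \<Sum>j\<in>UNIV. ?N $ i $ j * x $ i * x $ j)"
      by (simp add: matrix_matrix_mult_def transpose_def sum_distrib_right sum_distrib_left mult_ac)
    finally show ?thesis .
  qed
  then show ?thesis unfolding quad_forms_def by blast
qed

lemma quad_forms_mono: "R \<subseteq> S \<Longrightarrow> quad_forms R \<subseteq> quad_forms S"
  unfolding quad_forms_def by blast

lemma real_extension:
  fixes A :: "rat ^ 3 \<Rightarrow> rat"
  assumes "A \<in> quad_forms UNIV"
  obtains f :: "real ^ 3 \<Rightarrow> real"
  where "f \<in> quad_forms \<rat>" "\<And>u. f (int_vec u) = of_rat (A (int_vec u))"
proof -
  let ?f = "\<lambda>x :: real ^ 3. of_rat (A (pt 1 0 0)) * (x$1)\<^sup>2 + of_rat (A (pt 0 1 0)) * (x$2)\<^sup>2 + of_rat (A (pt 0 0 1)) * (x$3)\<^sup>2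
      + of_rat (A (pt 1 1 0) - A (pt 1 0 0) - A (pt 0 1 0)) * x$1 * x$2
      + of_rat (A (pt 1 0 1) - A (pt 1 0 0) - A (pt 0 0 1)) * x$1 * x$3
      + of_rat (A (pt 0 1 1) - A (pt 0 1 0) - A (pt 0 0 1)) * x$2 * x$3"
  have "?f \<in> quad_forms \<rat>" by (rule quad_formI[OF _ _ _ _ _ _ _ refl]) auto
  moreover have "?f (int_vec u) = of_rat (A (int_vec u))" for u
    by (subst quad_form_expand[OF assms, of "int_vec u"])
       (simp only: of_rat_add of_rat_mult of_rat_power of_rat_of_int_eq int_vec_nth)
  ultimately show thesis by (rule that)
qed

text \<open>Clearing denominators scales the value by a positive square.\<close>

lemma pos_definite_rat_iff:
  fixes A :: "rat ^ 3 \<Rightarrow> rat"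
  assumes "A \<in> quad_forms UNIV"
  shows "pos_definite A \<longleftrightarrow> (\<forall>u. u \<noteq> 0 \<longrightarrow> A (int_vec u) > 0)"
proof
  assume *: "\<forall>u. u \<noteq> 0 \<longrightarrow> A (int_vec u) > 0"
  show "pos_definite A" unfolding pos_definite_def
  proof (intro allI impI)
    fix x :: "rat ^ 3" assume "x \<noteq> 0"
    define q where "q i = snd (quotient_of (x $ i))" for i
    define p where "p i = fst (quotient_of (x $ i))" for i
    have q: "q i > 0" "of_int (q i) * x $ i = of_int (p i)" for i
    proof -
      show "q i > 0" unfolding q_def by (rule quotient_of_denom_pos')
      moreover have "x $ i = of_int (p i) / of_int (q i)"
        by (rule quotient_of_div) (simp add: p_def q_def)
      ultimately show "of_int (q i) * x $ i = of_int (p i)" by simp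
    qed
    define k where "k = q 1 * q 2 * q 3"
    define u :: "int ^ 3" where "u = vector [p 1 * q 2 * q 3, q 1 * p 2 * q 3, q 1 * q 2 * p 3]"
    have k: "k > 0" unfolding k_def using q by simp
    have u: "int_vec u = (of_int k :: rat) *s x"
      unfolding vec_eq_iff by (simp add: forall_3 u_def k_def flip: q(2))
    have "u \<noteq> 0"
    proof
      assume "u = 0"
      then have "(of_int k :: rat) *s x = 0" using u by (metis int_vec_eq_0_iff)
      then show False using k \<open>x \<noteq> 0\<close> by (simp add: vec_eq_iff)
    qed
    then have "A (int_vec u) > 0" using * by blast
    then show "A x > 0" unfolding u quad_form_scale[OF assms] using k by (simp add: zero_less_mult_iff)
  qed
qed (simp add: pos_definite_def)

text \<open>The successive conditions that completing the square imposes, written in values of the form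
  at integer vectors: in this shape they carry over between the rationals and the reals and are
  stable under small perturbations.\<close>

definition minor2 :: "('a::field ^ 3 \<Rightarrow> 'a) \<Rightarrow> 'a" where
  "minor2 f = 4 * f (pt 1 0 0) * f (pt 0 1 0) - (f (pt 1 1 0) - f (pt 1 0 0) - f (pt 0 1 0))\<^sup>2"

definition minor3 :: "('a::field ^ 3 \<Rightarrow> 'a) \<Rightarrow> 'a" where
  "minor3 f = 4 * minor2 f * (4 * f (pt 1 0 0) * f (pt 0 0 1) - (f (pt 1 0 1) - f (pt 1 0 0) - f (pt 0 0 1))\<^sup>2)
     - (4 * f (pt 1 0 0) * (f (pt 0 1 1) - f (pt 0 1 0) - f (pt 0 0 1))
        - 2 * (f (pt 1 1 0) - f (pt 1 0 0) - f (pt 0 1 0)) * (f (pt 1 0 1) - f (pt 1 0 0) - f (pt 0 0 1)))\<^sup>2"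

lemma pos_definite_iff_minors:
  fixes f :: "'a::linordered_field ^ 3 \<Rightarrow> 'a"
  assumes f: "f \<in> quad_forms UNIV"
  shows "pos_definite f \<longleftrightarrow> f (pt 1 0 0) > 0 \<and> minor2 f > 0 \<and> minor3 f > 0"
proof -
  define a b c d e h where
    "a = f (pt 1 0 0)" and "b = f (pt 0 1 0)" and "c = f (pt 0 0 1)"
    and "d = f (pt 1 1 0) - f (pt 1 0 0) - f (pt 0 1 0)"
    and "e = f (pt 1 0 1) - f (pt 1 0 0) - f (pt 0 0 1)"
    and "h = f (pt 0 1 1) - f (pt 0 1 0) - f (pt 0 0 1)"
  have fx: "f x = a * (x$1)\<^sup>2 + b * (x$2)\<^sup>2 + c * (x$3)\<^sup>2 + d * x$1 * x$2 + e * x$1 * x$3 + h * x$2 * x$3" for x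
    using quad_form_expand[OF f, of x] unfolding a_def b_def c_def d_def e_def h_def .
  define \<beta> where "\<beta> = 4 * a * b - d\<^sup>2"
  define \<eta> where "\<eta> = 4 * a * h - 2 * d * e"
  define \<gamma> where "\<gamma> = 4 * \<beta> * (4 * a * c - e\<^sup>2) - \<eta>\<^sup>2"
  have m: "minor2 f = \<beta>" "minor3 f = \<gamma>"
    by (simp_all add: minor2_def minor3_def \<beta>_def \<gamma>_def \<eta>_def a_def b_def c_def d_def e_def h_def)
  \<comment> \<open>Lagrange: the square is completed in the first variable, then in the second.\<close>
  have sq: "16 * a * \<beta> * f x = 4 * \<beta> * (2 * a * x$1 + d * x$2 + e * x$3)\<^sup>2 + (2 * \<beta> * x$2 + \<eta> * x$3)\<^sup>2 + \<gamma> * (x$3)\<^sup>2" for x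
    unfolding fx \<gamma>_def \<eta>_def \<beta>_def by algebra
  show ?thesis unfolding m
  proof (intro iffI conjI)
    assume pd: "pos_definite f"
    have pos: "f x > 0" if "x $ 1 \<noteq> 0 \<or> x $ 2 \<noteq> 0 \<or> x $ 3 \<noteq> 0" for x
    proof -
      have "x \<noteq> 0" using that by auto
      then show ?thesis using pd unfolding pos_definite_def by blast
    qed
    show "f (pt 1 0 0) > 0" by (rule pos) simp
    then have a: "a > 0" by (simp add: a_def)
    have "f (vector [-d, 2 * a, 0]) > 0" by (rule pos) (use a in simp)
    also have "f (vector [-d, 2 * a, 0]) = a * \<beta>"
      unfolding fx \<beta>_def by (simp add: algebra_simps power2_eq_square)
    finally show \<beta>: "\<beta> > 0" using a by (simp add: zero_less_mult_iff)
    \<comment> \<open>The point where the first two squares vanish.\<close>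
    define x :: "'a ^ 3" where "x = vector [- (d * (-\<eta>) + e * (2 * \<beta>)) / (2 * a), -\<eta>, 2 * \<beta>]"
    have "16 * a * \<beta> * f x = \<gamma> * (2 * \<beta>)\<^sup>2"
      unfolding sq by (use a in \<open>simp add: x_def field_simps\<close>)
    moreover have "f x > 0" by (rule pos) (use \<beta> in \<open>simp add: x_def\<close>)
    ultimately have "\<gamma> * (2 * \<beta>)\<^sup>2 > 0" using a \<beta> by (metis mult_pos_pos zero_less_numeral)
    then show "\<gamma> > 0" by (simp add: zero_less_mult_iff)
  next
    assume "0 < f (pt 1 0 0) \<and> 0 < \<beta> \<and> 0 < \<gamma>"
    then have p: "a > 0" "\<beta> > 0" "\<gamma> > 0" by (auto simp: a_def)
    show "pos_definite f" unfolding pos_definite_def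
    proof (intro allI impI)
      fix x :: "'a ^ 3" assume x: "x \<noteq> 0"
      have "16 * a * \<beta> * f x > 0"
      proof (cases "x $ 3 = 0")
        case False
        then have "0 < \<gamma> * (x$3)\<^sup>2" using p by simp
        moreover have "0 \<le> 4 * \<beta> * (2 * a * x$1 + d * x$2 + e * x$3)\<^sup>2" using p by simp
        moreover have "0 \<le> (2 * \<beta> * x$2 + \<eta> * x$3)\<^sup>2" by simp
        ultimately show ?thesis unfolding sq by linarith
      next
        case 3: True
        show ?thesis
        proof (cases "x $ 2 = 0")
          case False
          then have "0 < (2 * \<beta> * x$2 + \<eta> * x$3)\<^sup>2" using p 3 by simp
          moreover have "0 \<le> 4 * \<beta> * (2 * a * x$1 + d * x$2 + e * x$3)\<^sup>2" using p by simp
          ultimately have "0 < 4 * \<beta> * (2 * a * x$1 + d * x$2 + e * x$3)\<^sup>2 + (2 * \<beta> * x$2 + \<eta> * x$3)\<^sup>2"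
            by linarith
          then show ?thesis unfolding sq using 3 by simp
        next
          case True
          then have "x $ 1 \<noteq> 0" using x 3 by (simp add: vec_eq_iff forall_3)
          then show ?thesis unfolding sq using True 3 p by simp
        qed
      qed
      moreover have "0 < 16 * a * \<beta>" using p by simp
      ultimately show "f x > 0" by (rule zero_less_mult_pos)
    qed
  qed
qed

lemma pos_definite_real_extension:
  fixes A :: "rat ^ 3 \<Rightarrow> rat" and f :: "real ^ 3 \<Rightarrow> real"
  assumes "A \<in> quad_forms UNIV" "f \<in> quad_forms UNIV" "\<And>u. f (int_vec u) = of_rat (A (int_vec u))"
  shows "pos_definite f \<longleftrightarrow> pos_definite A"
proof -
  have 2: "minor2 f = of_rat (minor2 A)"
    by (simp add: minor2_def assms(3) of_rat_diff of_rat_mult of_rat_power)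
  have 3: "minor3 f = of_rat (minor3 A)"
    by (simp add: minor3_def 2 assms(3) of_rat_diff of_rat_mult of_rat_power)
  show ?thesis
    by (simp add: pos_definite_iff_minors[OF assms(1)] pos_definite_iff_minors[OF assms(2)] 2 3 assms(3))
qed

lemma eventually_pos_definite:
  fixes f :: "real ^ 3 \<Rightarrow> real"
  assumes "f \<in> quad_forms UNIV" "\<And>n. F n \<in> quad_forms UNIV" "pos_definite f"
    and lim: "\<And>u. (\<lambda>n. F n (int_vec u)) \<longlonglongrightarrow> f (int_vec u)"
  shows "eventually (\<lambda>n. pos_definite (F n)) sequentially"
proof -
  have 2: "(\<lambda>n. minor2 (F n)) \<longlonglongrightarrow> minor2 f"
    unfolding minor2_def by (intro tendsto_intros lim)
  have 3: "(\<lambda>n. minor3 (F n)) \<longlonglongrightarrow> minor3 f"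
    unfolding minor3_def by (intro tendsto_intros lim 2)
  have "f (pt 1 0 0) > 0" "minor2 f > 0" "minor3 f > 0"
    using assms(3) pos_definite_iff_minors[OF assms(1)] by auto
  then have "eventually (\<lambda>n. F n (pt 1 0 0) > 0) sequentially"
    "eventually (\<lambda>n. minor2 (F n) > 0) sequentially" "eventually (\<lambda>n. minor3 (F n) > 0) sequentially"
    using order_tendstoD(1)[OF lim] order_tendstoD(1)[OF 2] order_tendstoD(1)[OF 3] by blast+
  then show ?thesis
    by eventually_elim (simp add: pos_definite_iff_minors[OF assms(2)])
qed

text \<open>Positive definiteness is an open condition, so a small multiple of the sum of three squares can
  be subtracted without losing it.\<close>

lemma pos_definite_coercive:
  fixes A :: "rat ^ 3 \<Rightarrow> rat"
  assumes A: "A \<in> quad_forms UNIV" and pd: "pos_definite A"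
  obtains \<kappa> where "\<kappa> > 0" "\<And>u i. \<kappa> * (of_int (u $ i))\<^sup>2 \<le> A (int_vec u)"
proof -
  obtain f :: "real ^ 3 \<Rightarrow> real" where f: "f \<in> quad_forms \<rat>"
    and fA: "\<And>u. f (int_vec u) = of_rat (A (int_vec u))" by (rule real_extension[OF A], rule that)
  have f': "f \<in> quad_forms UNIV" using f quad_forms_mono by blast
  let ?N = "\<lambda>x :: real ^ 3. (x$1)\<^sup>2 + (x$2)\<^sup>2 + (x$3)\<^sup>2"
  have N: "?N \<in> quad_forms UNIV" by (rule quad_formI[of 1 _ 1 1 0 0 0]) auto
  define F where "F n = (\<lambda>x. 1 * f x + (- inverse (real (Suc n))) * ?N x)" for n
  have F: "F n \<in> quad_forms UNIV" for n unfolding F_def by (rule quad_forms_lincomb[OF f' N])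
  have "(\<lambda>n. F n (int_vec u)) \<longlonglongrightarrow> 1 * f (int_vec u) + (- 0) * ?N (int_vec u)" for u
    unfolding F_def by (intro tendsto_intros LIMSEQ_inverse_real_of_nat)
  then have "eventually (\<lambda>n. pos_definite (F n)) sequentially"
    using pd by (intro eventually_pos_definite[OF f' F]) (simp_all add: pos_definite_real_extension[OF A f' fA])
  then obtain n where n: "pos_definite (F n)" by (auto simp: eventually_sequentially)
  show thesis
  proof
    show "inverse (of_nat (Suc n) :: rat) > 0" by simp
    fix u i
    have "F n (int_vec u) \<ge> 0"
      using n quad_form_0[OF F] unfolding pos_definite_def by (metis less_le order_refl)
    then have "inverse (real (Suc n)) * ?N (int_vec u) \<le> of_rat (A (int_vec u))"
      by (simp add: F_def fA)
    moreover have "(of_int (u $ i))\<^sup>2 \<le> ?N (int_vec u)"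
      using exhaust_3[of i] by auto
    then have "inverse (real (Suc n)) * (of_int (u $ i))\<^sup>2 \<le> inverse (real (Suc n)) * ?N (int_vec u)"
      by (intro mult_left_mono) auto
    ultimately have "inverse (real (Suc n)) * (of_int (u $ i))\<^sup>2 \<le> of_rat (A (int_vec u))"
      by (rule order_trans[rotated])
    also have "inverse (real (Suc n)) * (of_int (u $ i))\<^sup>2 = of_rat (inverse (of_nat (Suc n)) * (of_int (u $ i))\<^sup>2)"
      by (simp add: of_rat_mult of_rat_power of_rat_inverse of_rat_add)
    finally show "inverse (of_nat (Suc n)) * (of_int (u $ i))\<^sup>2 \<le> A (int_vec u)"
      by (simp only: of_rat_less_eq)
  qed
qed

text \<open>The source of all finiteness in the proof: a definite form is bounded on only finitely many integer
  vectors, and these are the candidates for the rows of a transformation.\<close>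

lemma finite_bounded_matrices:
  fixes A :: "rat ^ 3 \<Rightarrow> rat"
  assumes A: "A \<in> quad_forms UNIV" and pd: "pos_definite A"
  shows "finite {w :: int ^ 3 ^ 3. \<forall>i. A (int_vec (w $ i)) \<le> C i}"
proof -
  obtain \<kappa> where \<kappa>: "\<kappa> > 0" "\<And>u i. \<kappa> * (of_int (u $ i))\<^sup>2 \<le> A (int_vec u)"
    by (rule pos_definite_coercive[OF A pd], rule that)
  define K where "K i = \<lceil>C i / \<kappa>\<rceil>" for i
  have K: "\<bar>w $ i $ j\<bar> \<le> K i" if "\<forall>i. A (int_vec (w $ i)) \<le> C i" for w :: "int ^ 3 ^ 3" and i j
  proof -
    have "\<kappa> * (of_int (w $ i $ j))\<^sup>2 \<le> C i" using \<kappa>(2) that order_trans by blast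
    then have "of_int ((w $ i $ j)\<^sup>2) \<le> C i / \<kappa>" using \<kappa>(1) by (simp add: field_simps)
    also have "\<dots> \<le> of_int (K i)" by (simp add: K_def)
    finally have "(w $ i $ j)\<^sup>2 \<le> K i" by (simp only: of_int_le_iff)
    moreover have "\<bar>w $ i $ j\<bar> \<le> (w $ i $ j)\<^sup>2"
      using self_le_power[of "\<bar>w $ i $ j\<bar>" 2] by (cases "w $ i $ j = 0") (simp_all only: power2_abs, simp_all)
    ultimately show ?thesis by linarith
  qed
  define L where "L = Max (range K)"
  have "{w. \<forall>i. A (int_vec (w $ i)) \<le> C i} \<subseteq> 
     (\<lambda>w. \<chi> i j. w (i, j)) ` (PiE (UNIV :: (3 \<times> 3) set) (\<lambda>_. {-L..L}))"
  proof
    fix w :: "int ^ 3 ^ 3" assume w: "w \<in> {w. \<forall>i. A (int_vec (w $ i)) \<le> C i}"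
    have "\<bar>w $ i $ j\<bar> \<le> L" for i j
    proof -
      have "\<bar>w $ i $ j\<bar> \<le> K i" using K w by blast
      also have "K i \<le> L" unfolding L_def by (rule Max_ge) auto
      finally show ?thesis .
    qed
    then have "(\<lambda>(i,j). w $ i $ j) \<in> PiE UNIV (\<lambda>_. {-L..L})"
      by (auto simp: abs_le_iff minus_le_iff)
    moreover have "w = (\<lambda>w. \<chi> i j. w (i, j)) (\<lambda>(i,j). w $ i $ j)" by (simp add: vec_eq_iff)
    ultimately show "w \<in> (\<lambda>w. \<chi> i j. w (i, j)) ` (PiE (UNIV :: (3 \<times> 3) set) (\<lambda>_. {-L..L}))"
      using image_eqI[of w "\<lambda>w. \<chi> i j. w (i, j)" "\<lambda>(i,j). w $ i $ j"] by blast
  qed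
  then show ?thesis by (rule finite_subset) (intro finite_imageI finite_PiE; simp)
qed

section \<open>Rational linear functionals on the reals\<close>

text \<open>A rational linear functional on the reals turns a real form into a rational one, and applying two
  of them turns equal value sets of real forms into equal value sets of pairs of rational forms.
  Working with all functionals replaces the choice of a basis of the rational span of the
  coefficients.\<close>

definition rat_linear :: "(real \<Rightarrow> rat) \<Rightarrow> bool" where
  "rat_linear \<phi> \<longleftrightarrow> (\<forall>x y. \<phi> (x + y) = \<phi> x + \<phi> y) \<and> (\<forall>q x. \<phi> (of_rat q * x) = q * \<phi> x)"

lemma rat_linear_add: "rat_linear \<phi> \<Longrightarrow> \<phi> (x + y) = \<phi> x + \<phi> y"
  and rat_linear_scale: "rat_linear \<phi> \<Longrightarrow> \<phi> (of_rat q * x) = q * \<phi> x"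
  by (simp_all add: rat_linear_def)

text \<open>Moving each element of a Hamel basis to a nearby rational number gives functionals that converge
  pointwise to the identity. This single sequence yields both facts that are needed: functionals
  separate real numbers, and some functional maps a given definite real form to a definite rational
  form.\<close>

lemma rat_linear_approximation:
  obtains \<Phi> :: "nat \<Rightarrow> real \<Rightarrow> rat"
  where "\<And>n. rat_linear (\<Phi> n)" "\<And>r. (\<lambda>n. of_rat (\<Phi> n r)) \<longlonglongrightarrow> r"
proof -
  interpret vector_space_pair "\<lambda>(q :: rat) (r :: real). of_rat q * r" "(*) :: rat \<Rightarrow> rat \<Rightarrow> rat"
    by unfold_locales (simp_all add: algebra_simps of_rat_add of_rat_mult)
  define B where "B = vs1.extend_basis {}"
  have B: "vs1.independent B" "vs1.span B = UNIV"
    unfolding B_def using vs1.independent_extend_basis vs1.span_extend_basis vs1.independent_empty by blast+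
  have "\<exists>q :: rat. \<bar>of_rat q - b\<bar> < inverse (real (Suc n))" for n and b :: real
  proof -
    obtain q where "b - inverse (real (Suc n)) < of_rat q" "of_rat q < b + inverse (real (Suc n))"
      using of_rat_dense[of "b - inverse (real (Suc n))" "b + inverse (real (Suc n))"]
      by (metis add_less_cancel_left diff_conv_add_uminus inverse_positive_iff_positive less_trans
          neg_less_0_iff_less of_nat_0_less_iff zero_less_Suc)
    then show ?thesis by (intro exI[of _ q]) (simp add: abs_less_iff)
  qed
  then have "\<forall>n. \<forall>b. \<exists>q :: rat. \<bar>of_rat q - b\<bar> < inverse (real (Suc n))" by blast
  from this[unfolded choice_iff] obtain Q :: "nat \<Rightarrow> real \<Rightarrow> rat"
    where Q: "\<And>n b. \<bar>of_rat (Q n b) - b\<bar> < inverse (real (Suc n))" by blast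
  define \<Phi> where "\<Phi> n = construct B (Q n)" for n
  have lin: "Vector_Spaces.linear (\<lambda>(q :: rat) (r :: real). of_rat q * r) (*) (\<Phi> n)" for n
    unfolding \<Phi>_def by (rule linear_construct[OF B(1)])
  have rl: "rat_linear (\<Phi> n)" for n
    unfolding rat_linear_def using linear_add[OF lin] linear_scale[OF lin] by blast
  show thesis
  proof
    show "rat_linear (\<Phi> n)" for n by (rule rl)
    fix r :: real
    have "r \<in> vs1.span B" using B(2) by simp
    then show "(\<lambda>n. of_rat (\<Phi> n r)) \<longlonglongrightarrow> r"
    proof (induction rule: vs1.span_induct_alt)
      case base
      have "\<Phi> n 0 = 0" for n using linear_0[OF lin] by blast
      then show ?case by simp
    next
      case (step c x y)
      have "\<Phi> n x = Q n x" for n unfolding \<Phi>_def by (rule construct_basis[OF B(1) step(1)])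
      then have "\<bar>of_rat (\<Phi> n x) - x\<bar> \<le> inverse (real (Suc n))" for n using Q[of n x] by simp
      then have "(\<lambda>n. of_rat (\<Phi> n x) - x) \<longlonglongrightarrow> 0"
        by (intro Lim_null_comparison[OF _ LIMSEQ_inverse_real_of_nat] always_eventually) simp
      then have "(\<lambda>n. of_rat (\<Phi> n x)) \<longlonglongrightarrow> x" by (simp add: LIM_zero_iff)
      then have "(\<lambda>n. of_rat c * of_rat (\<Phi> n x) + of_rat (\<Phi> n y)) \<longlonglongrightarrow> of_rat c * x + y"
        by (intro tendsto_intros step)
      then show ?case
        by (simp add: rat_linear_add[OF rl] rat_linear_scale[OF rl] of_rat_add of_rat_mult)
    qed
  qed
qed

lemma rat_linear_separate:
  assumes "\<And>\<phi>. rat_linear \<phi> \<Longrightarrow> \<phi> x = \<phi> y"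
  shows "x = y"
proof -
  obtain \<Phi> :: "nat \<Rightarrow> real \<Rightarrow> rat" where \<Phi>: "\<And>n. rat_linear (\<Phi> n)" "\<And>r. (\<lambda>n. of_rat (\<Phi> n r)) \<longlonglongrightarrow> r"
    using rat_linear_approximation by blast
  have "(\<lambda>n. real_of_rat (\<Phi> n x)) \<longlonglongrightarrow> y" using \<Phi>(2)[of y] assms[OF \<Phi>(1)] by simp
  then show ?thesis using \<Phi>(2)[of x] LIMSEQ_unique by blast
qed

lemma rat_linear_form:
  fixes f :: "real ^ 3 \<Rightarrow> real"
  assumes "rat_linear \<phi>" "f \<in> quad_forms UNIV"
  obtains A where "A \<in> quad_forms UNIV" "\<And>u. A (int_vec u) = \<phi> (f (int_vec u))"
proof -
  let ?A = "\<lambda>x :: rat ^ 3. \<phi> (f (pt 1 0 0)) * (x$1)\<^sup>2 + \<phi> (f (pt 0 1 0)) * (x$2)\<^sup>2 + \<phi> (f (pt 0 0 1)) * (x$3)\<^sup>2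
      + \<phi> (f (pt 1 1 0) - f (pt 1 0 0) - f (pt 0 1 0)) * x$1 * x$2
      + \<phi> (f (pt 1 0 1) - f (pt 1 0 0) - f (pt 0 0 1)) * x$1 * x$3
      + \<phi> (f (pt 0 1 1) - f (pt 0 1 0) - f (pt 0 0 1)) * x$2 * x$3"
  have scale: "\<phi> (x * of_int m * of_int n) = \<phi> x * of_int m * of_int n" for x m n
    using rat_linear_scale[OF assms(1), of "of_int (m * n)" x] by (simp add: of_rat_mult mult_ac)
  have "?A \<in> quad_forms UNIV" by (rule quad_formI[OF _ _ _ _ _ _ _ refl]) auto
  moreover have "?A (int_vec u) = \<phi> (f (int_vec u))" for u
    by (subst quad_form_expand[OF assms(2), of "int_vec u"])
       (simp only: rat_linear_add[OF assms(1)] scale int_vec_nth power2_eq_square mult.assoc[symmetric])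
  ultimately show thesis by (rule that)
qed

definition lin_closed :: "(real \<Rightarrow> rat) set \<Rightarrow> bool" where
  "lin_closed S \<longleftrightarrow> (\<forall>\<phi>\<in>S. \<forall>\<psi>\<in>S. \<forall>q. (\<lambda>r. \<phi> r + q * \<psi> r) \<in> S)"

lemma lin_closedD: "lin_closed S \<Longrightarrow> \<phi> \<in> S \<Longrightarrow> \<psi> \<in> S \<Longrightarrow> (\<lambda>r. \<phi> r + q * \<psi> r) \<in> S"
  by (simp add: lin_closed_def)

text \<open>A vector space over an infinite field is not a finite union of proper subspaces: a line through
  \<open>\<psi> \<notin> S\<close> in a direction \<open>\<phi> \<in> S\<close> avoids \<open>S\<close>, so, being infinite, it meets another
  member twice, and then that member contains the direction \<open>\<phi>\<close>.\<close>

lemma finite_cover_lin_closed: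
  assumes "finite \<F>" "\<And>S. S \<in> \<F> \<Longrightarrow> lin_closed S" "lin_closed T" "T \<noteq> {}" "T \<subseteq> \<Union>\<F>"
  shows "\<exists>S\<in>\<F>. T \<subseteq> S"
  using assms
proof (induction \<F> rule: finite_induct)
  case (insert S \<F>)
  show ?case
  proof (cases "T \<subseteq> \<Union>\<F> \<or> T \<subseteq> S")
    case True then show ?thesis using insert by auto
  next
    case False
    then obtain \<phi> \<psi> where \<phi>: "\<phi> \<in> T" "\<phi> \<in> S" "\<phi> \<notin> \<Union>\<F>" and \<psi>: "\<psi> \<in> T" "\<psi> \<notin> S"
      using insert.prems by blast
    have S: "lin_closed S" using insert.prems by simp
    define line where "line n = (\<lambda>r. \<psi> r + of_nat n * \<phi> r)" for n
    have "line n \<notin> S" for n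
    proof
      assume "line n \<in> S"
      then have "(\<lambda>r. line n r + (- of_nat n) * \<phi> r) \<in> S" using lin_closedD[OF S] \<phi> by blast
      then show False using \<psi> by (simp add: line_def)
    qed
    moreover have "line n \<in> T" for n
      unfolding line_def using lin_closedD[OF insert.prems(2)] \<phi> \<psi> by blast
    ultimately have "\<exists>R. R \<in> \<F> \<and> line n \<in> R" for n
      using subsetD[OF insert.prems(4), of "line n"] by auto
    then obtain R where R: "\<And>n. R n \<in> \<F>" "\<And>n. line n \<in> R n" by metis
    have "\<not> inj R"
      using insert.hyps(1) R(1) by (metis finite_subset finite_imageD image_subsetI infinite_UNIV_nat)
    then obtain m n where mn: "R m = R n" "m \<noteq> n" unfolding inj_def by blast
    define t :: rat where "t = of_nat n - of_nat m"
    have t: "t \<noteq> 0" using mn by (simp add: t_def)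
    have cl: "lin_closed (R n)" using insert.prems R by blast
    \<comment> \<open>Two points of the line in one subspace recover its direction.\<close>
    have "(\<lambda>r. line n r + (- 1) * line m r) \<in> R n" using lin_closedD[OF cl] R(2) mn by metis
    then have "(\<lambda>r. t * \<phi> r) \<in> R n" by (simp add: line_def t_def algebra_simps)
    from lin_closedD[OF cl this this, of "1 / t - 1"]
    have "(\<lambda>r. t * \<phi> r + (1 / t - 1) * (t * \<phi> r)) \<in> R n" .
    moreover have "t * \<phi> r + (1 / t - 1) * (t * \<phi> r) = \<phi> r" for r using t by (simp add: field_simps)
    ultimately have "\<phi> \<in> R n" by simp
    then show ?thesis using \<phi>(3) R(1) by blast
  qed
qed auto

section \<open>Integral equivalence and the exceptional pairs\<close>

lemma invertible_vec_mult:
  fixes w :: "int ^ 3 ^ 3"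
  assumes "invertible w"
  obtains w' where "invertible w'" "\<And>u. (u v* w) v* w' = u" "\<And>u. (u v* w') v* w = u"
proof -
  from assms obtain w' where w': "w ** w' = mat 1" "w' ** w = mat 1" unfolding invertible_def by blast
  moreover have "invertible w'" using w' unfolding invertible_def by blast
  ultimately show thesis
    by (intro that[of w']) (simp_all add: vector_matrix_mul_assoc)
qed

lemma axis_vec_mult: "axis i 1 v* w = w $ i" for w :: "int ^ 3 ^ 3"
  using exhaust_3[of i] by (auto simp: vec_eq_iff vector_matrix_mult_def axis_def sum_3)

lemma int_vec_mult_nonzero:
  fixes u :: "int ^ 3" and w :: "int ^ 3 ^ 3"
  assumes "invertible w" "u \<noteq> 0" shows "u v* w \<noteq> 0"
proof
  assume *: "u v* w = 0"
  obtain w' where "\<And>u. (u v* w) v* w' = u" using invertible_vec_mult[OF assms(1)] by metis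
  then have "u = 0 v* w'" using * by metis
  then show False using assms(2) by (simp add: vector_matrix_mult_def vec_eq_iff)
qed

text \<open>The two exceptional families of pairs differ in the square that is added (selected by \<open>k\<close>);
  within a family the two members differ by \<open>s\<close>, which selects the norm form of the
  Eisenstein integers or that of its sublattice generated by 1 and the square root of -3. Either
  order of the members is thus covered by letting \<open>s\<close> vary.\<close>

definition norm_form :: "bool \<Rightarrow> 'a::field ^ 3 \<Rightarrow> 'a" where
  "norm_form s x = (if s then (x$1)\<^sup>2 + 3 * (x$2)\<^sup>2 else (x$1)\<^sup>2 - x$1 * x$2 + (x$2)\<^sup>2)"

definition line_form :: "bool \<Rightarrow> bool \<Rightarrow> 'a::field ^ 3 \<Rightarrow> 'a" where
  "line_form k s x = (if k then if s then x$1 + 3 * x$3 else x$1 + x$2 + 3 * x$3 else x$3)"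

definition pencil :: "bool \<Rightarrow> bool \<Rightarrow> 'a::field \<Rightarrow> 'a \<Rightarrow> 'a ^ 3 \<Rightarrow> 'a" where
  "pencil k s c d x = c * norm_form s x + d * (line_form k s x)\<^sup>2"

text \<open>\<open>f\<close> and \<open>g\<close> are carried to the two members of an exceptional pair with the common
  coefficients \<open>c\<close> and \<open>d\<close>. With fixed matrices this condition is linear in \<open>(f, g, c, d)\<close>, a
  property that both directions of the equivalence exploit.\<close>

definition twin :: "bool \<Rightarrow> bool \<Rightarrow> 'a::field \<Rightarrow> 'a \<Rightarrow> ('a ^ 3 \<Rightarrow> 'a) \<Rightarrow> ('a ^ 3 \<Rightarrow> 'a)
    \<Rightarrow> int ^ 3 ^ 3 \<Rightarrow> int ^ 3 ^ 3 \<Rightarrow> bool" where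
  "twin k s c d f g w\<^sub>1 w\<^sub>2 \<longleftrightarrow>
     (\<forall>u. f (int_vec u) = pencil k s c d (int_vec (u v* w\<^sub>1)) \<and>
          g (int_vec u) = pencil k (\<not> s) c d (int_vec (u v* w\<^sub>2)))"

lemma norm_form_quad: "norm_form s \<in> quad_forms UNIV"
proof (cases s)
  case True show ?thesis by (rule quad_formI[of 1 _ 3 0 0 0 0]) (simp_all add: norm_form_def True)
next
  case False show ?thesis by (rule quad_formI[of 1 _ 1 0 "- 1" 0 0]) (simp_all add: norm_form_def False)
qed

lemma line_form_square_quad: "(\<lambda>x. (line_form k s x)\<^sup>2) \<in> quad_forms UNIV"
proof -
  consider "\<not> k" | "k" "s" | "k" "\<not> s" by blast
  then show ?thesis
  proof cases
    case 1 show ?thesis by (rule quad_formI[of 0 _ 0 1 0 0 0]) (simp_all add: line_form_def 1)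
  next
    case 2 show ?thesis
      by (rule quad_formI[of 1 _ 0 9 0 6 0]) (simp_all add: line_form_def 2 power2_eq_square algebra_simps)
  next
    case 3 show ?thesis
      by (rule quad_formI[of 1 _ 1 9 2 6 6]) (simp_all add: line_form_def 3 power2_eq_square algebra_simps)
  qed
qed

lemma pencil_quad: "pencil k s c d \<in> quad_forms UNIV"
  using quad_forms_lincomb[OF norm_form_quad line_form_square_quad] by (simp add: pencil_def[abs_def])

lemma pencil_of_rat: "pencil k s (of_rat c) (of_rat d) (int_vec u) = of_rat (pencil k s c d (int_vec u))"
  by (simp add: pencil_def norm_form_def line_form_def of_rat_add of_rat_diff of_rat_mult of_rat_power)

text \<open>Each of the two generators of a pencil vanishes at an integer point where the other one does not.
  So the coefficients of a pencil are rational multiples of values of the form at integer vectors.\<close>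

definition norm_point :: "bool \<Rightarrow> int ^ 3" where
  "norm_point s = (if s then vector [0, 1, 0] else vector [1, - 1, 0])"

definition line_point :: "int ^ 3" where
  "line_point = vector [0, 0, 1]"

definition line_weight :: "bool \<Rightarrow> 'a::field" where
  "line_weight k = (if k then 9 else 1)"

lemma pencil_norm_point: "pencil k s c d (int_vec (norm_point s)) = 3 * c"
  by (simp add: pencil_def norm_form_def line_form_def norm_point_def)

lemma pencil_line_point: "pencil k s c d (int_vec line_point) = line_weight k * d"
  by (simp add: pencil_def norm_form_def line_form_def line_point_def line_weight_def)

lemma pencil_points_nonzero: "norm_point s \<noteq> 0" "line_point \<noteq> 0"
  by (auto simp: norm_point_def line_point_def vec_eq_iff forall_3)

lemma norm_form_nonneg: "norm_form s x \<ge> 0" for x :: "rat ^ 3"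
proof -
  have "(x$1)\<^sup>2 - x$1 * x$2 + (x$2)\<^sup>2 = (x$1 - x$2 / 2)\<^sup>2 + 3 * (x$2 / 2)\<^sup>2"
    by (simp add: power2_eq_square field_simps)
  moreover have "\<dots> \<ge> 0" by (intro add_nonneg_nonneg) auto
  ultimately show ?thesis by (simp add: norm_form_def)
qed

lemma pos_definite_pencil: "pos_definite (pencil k s 1 1 :: rat ^ 3 \<Rightarrow> rat)"
  by (subst pos_definite_iff_minors[OF pencil_quad])
     (auto simp: minor2_def minor3_def pencil_def norm_form_def line_form_def)

lemma pencil_lincomb:
  "pencil k s (\<alpha> * p + \<beta> * p') (\<alpha> * q + \<beta> * q') x = \<alpha> * pencil k s p q x + \<beta> * pencil k s p' q' x"
  by (simp add: pencil_def algebra_simps)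

lemma finite_isometries:
  fixes A' :: "rat ^ 3 \<Rightarrow> rat"
  assumes "A' \<in> quad_forms UNIV" "pos_definite A'"
  shows "finite {w :: int ^ 3 ^ 3. \<forall>u. A (int_vec u) = A' (int_vec (u v* w))}"
proof (rule finite_subset[OF _ finite_bounded_matrices[OF assms]])
  show "{w. \<forall>u. A (int_vec u) = A' (int_vec (u v* w))} \<subseteq>
      {w. \<forall>i. A' (int_vec (w $ i)) \<le> A (int_vec (axis i 1))}"
    by (auto simp: axis_vec_mult)
qed

text \<open>The coefficients \<open>p\<close> and \<open>q\<close> are not given, but up to bounded factors they are values
  of \<open>A\<close> at nonzero integer vectors, hence bounded below. Therefore \<open>A\<close> dominates a fixed
  multiple of the transformed definite form \<open>pencil k s 1 1\<close>, and the rows of \<open>w\<close> are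
  short for the latter.\<close>

lemma finite_pencil_isometries:
  fixes A :: "rat ^ 3 \<Rightarrow> rat"
  assumes A: "A \<in> quad_forms UNIV" and pd: "pos_definite A"
  shows "finite {w. invertible w \<and> (\<exists>p q. \<forall>u. A (int_vec u) = pencil k s p q (int_vec (u v* w)))}"
proof -
  obtain \<kappa> where \<kappa>: "\<kappa> > 0" "\<And>u i. \<kappa> * (of_int (u $ i))\<^sup>2 \<le> A (int_vec u)"
    by (rule pos_definite_coercive[OF A pd], rule that)
  have low: "\<kappa> \<le> A (int_vec u)" if "u \<noteq> 0" for u
  proof -
    from that obtain i where "u $ i \<noteq> 0" by (auto simp: vec_eq_iff)
    then have "1 \<le> \<bar>u $ i\<bar>" by linarith
    then have "1 \<le> \<bar>u $ i\<bar>\<^sup>2" by (rule one_le_power)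
    then have "(1 :: rat) \<le> of_int ((u $ i)\<^sup>2)" by (simp only: of_int_1_le_iff power2_abs)
    then have "\<kappa> * 1 \<le> \<kappa> * (of_int (u $ i))\<^sup>2" using \<kappa>(1) by (intro mult_left_mono) auto
    then show ?thesis using \<kappa>(2)[of u i] by linarith
  qed
  show ?thesis
  proof (rule finite_subset[OF _ finite_bounded_matrices[OF pencil_quad pos_definite_pencil]], rule subsetI)
    fix w :: "int ^ 3 ^ 3"
    assume "w \<in> {w. invertible w \<and> (\<exists>p q. \<forall>u. A (int_vec u) = pencil k s p q (int_vec (u v* w)))}"
    then obtain p q where w: "invertible w"
      and pq: "\<And>u. A (int_vec u) = pencil k s p q (int_vec (u v* w))" by blast
    obtain w' where w': "invertible w'" "\<And>u. (u v* w') v* w = u"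
      by (rule invertible_vec_mult[OF w], rule that)
    have "A (int_vec (norm_point s v* w')) = 3 * p"
      unfolding pq w'(2) by (rule pencil_norm_point)
    moreover have "A (int_vec (line_point v* w')) = line_weight k * q"
      unfolding pq w'(2) by (rule pencil_line_point)
    ultimately have p: "\<kappa> \<le> 3 * p" and q: "\<kappa> \<le> line_weight k * q"
      using low int_vec_mult_nonzero[OF w'(1) pencil_points_nonzero(1)]
        int_vec_mult_nonzero[OF w'(1) pencil_points_nonzero(2)] by metis+
    have p': "\<kappa> / 9 \<le> p" using p \<kappa>(1) by simp
    have q': "\<kappa> / 9 \<le> q" using q \<kappa>(1) by (auto simp: line_weight_def split: if_splits)
    have "pencil k s 1 1 (int_vec (w $ i)) \<le> 9 * A (int_vec (axis i 1)) / \<kappa>" for i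
    proof -
      have "\<kappa> / 9 * pencil k s 1 1 (int_vec (w $ i)) \<le> pencil k s p q (int_vec (w $ i))"
        unfolding pencil_def distrib_left mult_1
        by (intro add_mono mult_right_mono p' q' norm_form_nonneg) simp
      also have "\<dots> = A (int_vec (axis i 1))" by (simp add: pq axis_vec_mult)
      finally show ?thesis using \<kappa>(1) by (simp add: field_simps)
    qed
    then show "w \<in> {w. \<forall>i. pencil k s 1 1 (int_vec (w $ i)) \<le> 9 * A (int_vec (axis i 1)) / \<kappa>}" by simp
  qed
qed

section \<open>From real forms to pairs of rational forms\<close>

text \<open>Independence and definiteness of a pair are conditions on its values at nonzero integer vectors,
  so they pass to every pair with the same value set.\<close>

lemma value_set_transfer:
  fixes F G :: "'a::ring_char_0 ^ 3 \<Rightarrow> 'b"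
  assumes "value_set \<int> F = value_set \<int> G"
  shows "(\<forall>u. u \<noteq> 0 \<longrightarrow> P (F (int_vec u))) \<longleftrightarrow> (\<forall>u. u \<noteq> 0 \<longrightarrow> P (G (int_vec u)))"
proof -
  have "(\<forall>u. u \<noteq> 0 \<longrightarrow> P (H (int_vec u))) \<longleftrightarrow> (\<forall>y\<in>value_set \<int> H. P y)" for H :: "'a ^ 3 \<Rightarrow> 'b"
    unfolding value_set_Ints by blast
  then show ?thesis using assms by simp
qed

lemma value_set_cong:
  fixes F F' :: "'a::ring_char_0 ^ 3 \<Rightarrow> 'b" and G G' :: "'c::ring_char_0 ^ 3 \<Rightarrow> 'd"
  assumes "value_set \<int> F = value_set \<int> F'" "\<And>u. G (int_vec u) = \<tau> (F (int_vec u))"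
    "\<And>u. G' (int_vec u) = \<tau> (F' (int_vec u))"
  shows "value_set \<int> G = value_set \<int> G'"
proof -
  have "value_set \<int> G = \<tau> ` value_set \<int> F" unfolding value_set_Ints assms(2) by blast
  moreover have "value_set \<int> G' = \<tau> ` value_set \<int> F'" unfolding value_set_Ints assms(3) by blast
  ultimately show ?thesis using assms(1) by simp
qed

lemma lin_indep_forms_iff_values:
  fixes A B :: "rat ^ 3 \<Rightarrow> rat"
  assumes "A \<in> quad_forms UNIV" "B \<in> quad_forms UNIV"
  shows "lin_indep_forms A B \<longleftrightarrow>
    (\<forall>a b. (\<forall>u. u \<noteq> 0 \<longrightarrow> a * A (int_vec u) + b * B (int_vec u) = 0) \<longrightarrow> a = 0 \<and> b = 0)"
proof -
  have "(\<forall>x. a * A x + b * B x = 0) \<longleftrightarrow> (\<forall>u. u \<noteq> 0 \<longrightarrow> a * A (int_vec u) + b * B (int_vec u) = 0)" for a b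
  proof
    assume *: "\<forall>u. u \<noteq> 0 \<longrightarrow> a * A (int_vec u) + b * B (int_vec u) = 0"
    have "a * A (int_vec u) + b * B (int_vec u) = 0 * A (int_vec u) + 0 * B (int_vec u)" for u
      using * quad_form_0[OF assms(1)] quad_form_0[OF assms(2)] by (cases "u = 0") simp_all
    then have "(\<lambda>x. a * A x + b * B x) = (\<lambda>x. 0 * A x + 0 * B x)"
      by (intro quad_forms_eqI quad_forms_lincomb assms)
    then show "\<forall>x. a * A x + b * B x = 0" by (simp add: fun_eq_iff)
  qed blast
  then show ?thesis unfolding lin_indep_forms_def by simp
qed

lemma lin_indep_forms_transfer:
  fixes A\<^sub>1 B\<^sub>1 A\<^sub>2 B\<^sub>2 :: "rat ^ 3 \<Rightarrow> rat"
  assumes "A\<^sub>1 \<in> quad_forms UNIV" "B\<^sub>1 \<in> quad_forms UNIV" "A\<^sub>2 \<in> quad_forms UNIV" "B\<^sub>2 \<in> quad_forms UNIV"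
    and "value_set \<int> (\<lambda>x. (A\<^sub>1 x, B\<^sub>1 x)) = value_set \<int> (\<lambda>x. (A\<^sub>2 x, B\<^sub>2 x))"
  shows "lin_indep_forms A\<^sub>1 B\<^sub>1 \<longleftrightarrow> lin_indep_forms A\<^sub>2 B\<^sub>2"
  using value_set_transfer[OF assms(5), of "\<lambda>(s, t). a * s + b * t = 0" for a b]
  by (simp add: lin_indep_forms_iff_values assms)

lemma pos_definite_transfer:
  fixes A\<^sub>1 B\<^sub>1 A\<^sub>2 B\<^sub>2 :: "rat ^ 3 \<Rightarrow> rat"
  assumes "A\<^sub>1 \<in> quad_forms UNIV" "B\<^sub>1 \<in> quad_forms UNIV" "A\<^sub>2 \<in> quad_forms UNIV" "B\<^sub>2 \<in> quad_forms UNIV"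
    and "value_set \<int> (\<lambda>x. (A\<^sub>1 x, B\<^sub>1 x)) = value_set \<int> (\<lambda>x. (A\<^sub>2 x, B\<^sub>2 x))"
  shows "pos_definite (\<lambda>x. c * A\<^sub>1 x + d * B\<^sub>1 x) \<longleftrightarrow> pos_definite (\<lambda>x. c * A\<^sub>2 x + d * B\<^sub>2 x)"
  using value_set_transfer[OF assms(5), of "\<lambda>(s, t). 0 < c * s + d * t"]
  by (simp add: pos_definite_rat_iff quad_forms_lincomb assms)

lemma pos_definite_at_unit: "pos_definite f \<Longrightarrow> f (pt 1 0 0) > 0"
  for f :: "'a::linordered_field ^ 3 \<Rightarrow> 'a"
  unfolding pos_definite_def by (auto simp: vec_eq_iff forall_3)

text \<open>For quadratic forms, agreement on integer vectors is the same as agreement everywhere.\<close>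

definition isom :: "('a::ring_1 ^ 3 \<Rightarrow> 'a) \<Rightarrow> ('a ^ 3 \<Rightarrow> 'a) \<Rightarrow> int ^ 3 ^ 3 \<Rightarrow> bool" where
  "isom f g w \<longleftrightarrow> (\<forall>u. f (int_vec u) = g (int_vec (u v* w)))"

abbreviation (input) rational_multiples :: "(real ^ 3 \<Rightarrow> real) set" where
  "rational_multiples \<equiv> {\<lambda>x. r * h x | r h. r \<noteq> 0 \<and> h \<in> quad_forms \<rat>}"

lemma quad_forms_Rats_int_vec:
  fixes h :: "real ^ 3 \<Rightarrow> real"
  assumes "h \<in> quad_forms \<rat>"
  shows "h (int_vec u) \<in> \<rat>"
  using assms unfolding quad_forms_def by (auto intro!: Rats_sum Rats_mult)

text \<open>The real forms are \<open>\<alpha> A\<^sub>i + \<beta> B\<^sub>i\<close> with \<open>\<alpha>\<close> and \<open>\<beta>\<close> linearly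
  independent over the rationals and close to \<open>c\<close> and \<open>d\<close>, so that the forms are definite.
  Independence of \<open>\<alpha>\<close> and \<open>\<beta>\<close> allows comparing coefficients in every identity between
  these real forms. Since \<open>A\<^sub>1\<close> and \<open>B\<^sub>1\<close> are independent too, the first real form is not
  proportional to a rational one.\<close>

theorem real_to_rational:
  fixes A\<^sub>1 B\<^sub>1 A\<^sub>2 B\<^sub>2 :: "rat ^ 3 \<Rightarrow> rat"
  assumes K: "\<And>f g. f \<in> quad_forms UNIV \<Longrightarrow> g \<in> quad_forms UNIV \<Longrightarrow> pos_definite f \<Longrightarrow> pos_definite g \<Longrightarrow>
      f \<notin> rational_multiples \<Longrightarrow> value_set \<int> f = value_set \<int> g \<Longrightarrow>
      (\<exists>w. invertible w \<and> isom f g w) \<or>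
      (\<exists>k s c d w\<^sub>1 w\<^sub>2. invertible w\<^sub>1 \<and> invertible w\<^sub>2 \<and> twin k s c d f g w\<^sub>1 w\<^sub>2)"
    and A1: "A\<^sub>1 \<in> quad_forms UNIV" and B1: "B\<^sub>1 \<in> quad_forms UNIV"
    and A2: "A\<^sub>2 \<in> quad_forms UNIV" and B2: "B\<^sub>2 \<in> quad_forms UNIV"
    and ind: "lin_indep_forms A\<^sub>1 B\<^sub>1" and pd: "pos_definite (\<lambda>x. c * A\<^sub>1 x + d * B\<^sub>1 x)"
    and vals: "value_set \<int> (\<lambda>x. (A\<^sub>1 x, B\<^sub>1 x)) = value_set \<int> (\<lambda>x. (A\<^sub>2 x, B\<^sub>2 x))"
  shows "(\<exists>w. invertible w \<and> isom A\<^sub>1 A\<^sub>2 w \<and> isom B\<^sub>1 B\<^sub>2 w) \<or>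
    (\<exists>k s w\<^sub>1 w\<^sub>2 p q p' q'. invertible w\<^sub>1 \<and> invertible w\<^sub>2 \<and>
       twin k s p q A\<^sub>1 A\<^sub>2 w\<^sub>1 w\<^sub>2 \<and> twin k s p' q' B\<^sub>1 B\<^sub>2 w\<^sub>1 w\<^sub>2)"
proof -
  have ext: "\<exists>f. f \<in> quad_forms UNIV \<and> (\<forall>u. f (int_vec u) = real_of_rat (A (int_vec u)))"
    if A: "A \<in> quad_forms UNIV" for A :: "rat ^ 3 \<Rightarrow> rat"
    using quad_forms_mono[of \<rat> UNIV] by (rule_tac real_extension[OF A]) blast
  obtain a1 where a1: "a1 \<in> quad_forms UNIV" "\<forall>u. a1 (int_vec u) = real_of_rat (A\<^sub>1 (int_vec u))" using ext[OF A1] by blast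
  obtain b1 where b1: "b1 \<in> quad_forms UNIV" "\<forall>u. b1 (int_vec u) = real_of_rat (B\<^sub>1 (int_vec u))" using ext[OF B1] by blast
  obtain a2 where a2: "a2 \<in> quad_forms UNIV" "\<forall>u. a2 (int_vec u) = real_of_rat (A\<^sub>2 (int_vec u))" using ext[OF A2] by blast
  obtain b2 where b2: "b2 \<in> quad_forms UNIV" "\<forall>u. b2 (int_vec u) = real_of_rat (B\<^sub>2 (int_vec u))" using ext[OF B2] by blast
  obtain \<theta> :: real where \<theta>: "\<theta> \<notin> \<rat>"
    using uncountable_UNIV_real countable_rat by (metis UNIV_eq_I)
  \<comment> \<open>The perturbation \<open>(- d, c)\<close> is orthogonal to \<open>(c, d)\<close>: the rational part and the irrational
    part of a linear relation then give two independent linear equations, because \<open>c\<close> and \<open>d\<close> are not both zero.\<close>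
  define \<epsilon> where "\<epsilon> n = \<theta> * inverse (real (Suc n))" for n
  define \<alpha> where "\<alpha> n = of_rat c - of_rat d * \<epsilon> n" for n
  define \<beta> where "\<beta> n = of_rat d + of_rat c * \<epsilon> n" for n
  have \<epsilon>0: "\<epsilon> \<longlonglongrightarrow> 0"
    unfolding \<epsilon>_def using tendsto_mult_left[OF LIMSEQ_inverse_real_of_nat, of \<theta>] by simp
  have \<alpha>: "\<alpha> \<longlonglongrightarrow> of_rat c - of_rat d * 0" and \<beta>: "\<beta> \<longlonglongrightarrow> of_rat d + of_rat c * 0"
    unfolding \<alpha>_def \<beta>_def by (intro tendsto_intros \<epsilon>0)+
  have ev: "eventually (\<lambda>n. pos_definite (\<lambda>x. \<alpha> n * a x + \<beta> n * b x)) sequentially"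
    if "A \<in> quad_forms UNIV" "B \<in> quad_forms UNIV" "pos_definite (\<lambda>x. c * A x + d * B x)"
      "a \<in> quad_forms UNIV" "b \<in> quad_forms UNIV"
      "\<forall>u. a (int_vec u) = real_of_rat (A (int_vec u))" "\<forall>u. b (int_vec u) = real_of_rat (B (int_vec u))" for A B a b
  proof (rule eventually_pos_definite)
    let ?f = "\<lambda>x. of_rat c * a x + of_rat d * b x"
    show "?f \<in> quad_forms UNIV" by (intro quad_forms_lincomb that)
    then show "pos_definite ?f"
      using that(3) by (subst pos_definite_real_extension[OF quad_forms_lincomb[OF that(1,2), of c d]])
        (simp_all add: that of_rat_add of_rat_mult)
    show "(\<lambda>x. \<alpha> n * a x + \<beta> n * b x) \<in> quad_forms UNIV" for n by (intro quad_forms_lincomb that)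
    show "(\<lambda>n. \<alpha> n * a (int_vec u) + \<beta> n * b (int_vec u)) \<longlonglongrightarrow> ?f (int_vec u)" for u
      using tendsto_add[OF tendsto_mult_right[OF \<alpha>] tendsto_mult_right[OF \<beta>]] by simp
  qed
  have pd2: "pos_definite (\<lambda>x. c * A\<^sub>2 x + d * B\<^sub>2 x)"
    using pd pos_definite_transfer[OF A1 B1 A2 B2 vals] by blast
  have "eventually (\<lambda>n. pos_definite (\<lambda>x. \<alpha> n * a1 x + \<beta> n * b1 x) \<and> pos_definite (\<lambda>x. \<alpha> n * a2 x + \<beta> n * b2 x)) sequentially"
    by (intro eventually_conj ev[OF A1 B1 pd a1(1) b1(1) a1(2) b1(2)] ev[OF A2 B2 pd2 a2(1) b2(1) a2(2) b2(2)])
  then obtain n where n: "pos_definite (\<lambda>x. \<alpha> n * a1 x + \<beta> n * b1 x)" "pos_definite (\<lambda>x. \<alpha> n * a2 x + \<beta> n * b2 x)"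
    by (auto simp: eventually_sequentially)
  define f where "f = (\<lambda>x. \<alpha> n * a1 x + \<beta> n * b1 x)"
  define g where "g = (\<lambda>x. \<alpha> n * a2 x + \<beta> n * b2 x)"
  have f: "f \<in> quad_forms UNIV" "pos_definite f" and g: "g \<in> quad_forms UNIV" "pos_definite g"
    unfolding f_def g_def by (intro quad_forms_lincomb a1 b1 a2 b2 n)+
  have fu: "f (int_vec u) = \<alpha> n * of_rat (A\<^sub>1 (int_vec u)) + \<beta> n * of_rat (B\<^sub>1 (int_vec u))"
    and gu: "g (int_vec u) = \<alpha> n * of_rat (A\<^sub>2 (int_vec u)) + \<beta> n * of_rat (B\<^sub>2 (int_vec u))" for u
    by (simp_all add: f_def g_def a1 b1 a2 b2)
  have cd: "c \<noteq> 0 \<or> d \<noteq> 0" using pos_definite_at_unit[OF pd] by auto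
  have zero: "p = 0 \<and> q = 0" if "\<alpha> n * of_rat p + \<beta> n * of_rat q = 0" for p q
  proof -
    have e: "of_rat (c * p + d * q) + \<epsilon> n * of_rat (c * q - d * p) = 0"
      using that unfolding \<alpha>_def \<beta>_def by (simp add: of_rat_add of_rat_diff of_rat_mult algebra_simps)
    have 1: "c * q - d * p = 0"
    proof (rule ccontr)
      assume nz: "c * q - d * p \<noteq> 0"
      then have nz': "of_rat (c * q - d * p) \<noteq> (0 :: real)" by (simp only: of_rat_eq_0_iff not_False_eq_True)
      have "\<epsilon> n = of_rat (- (c * p + d * q) / (c * q - d * p))"
        using e nz nz' unfolding of_rat_divide of_rat_minus by (simp only: eq_divide_eq) (simp add: algebra_simps)
      then have "\<theta> = of_rat (of_nat (Suc n) * (- (c * p + d * q) / (c * q - d * p)))"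
        unfolding \<epsilon>_def of_rat_mult of_rat_of_nat_eq by (simp add: field_simps)
      then show False using \<theta> by (metis Rats_of_rat)
    qed
    then have 2: "c * p + d * q = 0" using e by (simp only: of_rat_0 mult_zero_right add_0_right of_rat_eq_0_iff)
    have "(c\<^sup>2 + d\<^sup>2) * p = 0" "(c\<^sup>2 + d\<^sup>2) * q = 0" using 1 2 by algebra+
    then show ?thesis using cd by (auto simp: sum_power2_eq_zero_iff)
  qed
  have cancel: "p = p' \<and> q = q'" if "\<alpha> n * of_rat p + \<beta> n * of_rat q = \<alpha> n * of_rat p' + \<beta> n * of_rat q'" for p q p' q'
    using zero[of "p - p'" "q - q'"] that by (simp add: of_rat_diff algebra_simps)
  have irr: "f \<notin> rational_multiples"
  proof
    assume "f \<in> rational_multiples"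
    then obtain r h where h: "f = (\<lambda>x. r * h x)" "h \<in> quad_forms \<rat>" by blast
    have "\<forall>u. \<exists>q. h (int_vec u) = of_rat q" using quad_forms_Rats_int_vec[OF h(2)] by (meson Rats_cases)
    then obtain H where H: "\<And>u. h (int_vec u) = of_rat (H u)" by metis
    \<comment> \<open>If \<open>f\<close> were proportional to a rational form, then by comparing coefficients both \<open>A\<^sub>1\<close> and
      \<open>B\<^sub>1\<close> would be proportional to it.\<close>
    define v :: "int ^ 3" where "v = vector [1, 0, 0]"
    have "f (int_vec v) \<noteq> 0" using pos_definite_at_unit[OF f(2)] by (simp add: v_def)
    then have Hv: "H v \<noteq> 0" by (auto simp: h(1) H)
    have "H v * A\<^sub>1 (int_vec u) = H u * A\<^sub>1 (int_vec v) \<and> H v * B\<^sub>1 (int_vec u) = H u * B\<^sub>1 (int_vec v)" for u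
    proof (rule cancel)
      have "of_rat (H v) * f (int_vec u) = of_rat (H u) * f (int_vec v)" by (simp add: h(1) H)
      then show "\<alpha> n * of_rat (H v * A\<^sub>1 (int_vec u)) + \<beta> n * of_rat (H v * B\<^sub>1 (int_vec u))
        = \<alpha> n * of_rat (H u * A\<^sub>1 (int_vec v)) + \<beta> n * of_rat (H u * B\<^sub>1 (int_vec v))"
        unfolding fu by (simp add: of_rat_mult algebra_simps)
    qed
    then have ratio: "A\<^sub>1 (int_vec u) = H u / H v * A\<^sub>1 (int_vec v)" "B\<^sub>1 (int_vec u) = H u / H v * B\<^sub>1 (int_vec v)" for u
      using Hv by (simp_all add: field_simps)
    have null: "a = 0 \<and> b = 0" if "\<And>u. a * A\<^sub>1 (int_vec u) + b * B\<^sub>1 (int_vec u) = 0" for a b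
      using ind that unfolding lin_indep_forms_iff_values[OF A1 B1] by blast
    have "B\<^sub>1 (int_vec v) * A\<^sub>1 (int_vec u) + (- A\<^sub>1 (int_vec v)) * B\<^sub>1 (int_vec u) = 0" for u
      unfolding ratio(1)[of u] ratio(2)[of u] by simp
    from null[OF this] have "A\<^sub>1 (int_vec v) = 0" by simp
    then have "1 * A\<^sub>1 (int_vec u) + 0 * B\<^sub>1 (int_vec u) = 0" for u using ratio(1)[of u] by simp
    from null[OF this] show False by simp
  qed
  have vals': "value_set \<int> f = value_set \<int> g"
    by (rule value_set_cong[OF vals, of _ "\<lambda>(s, t). \<alpha> n * of_rat s + \<beta> n * of_rat t"]) (simp_all add: fu gu)
  from K[OF f(1) g(1) f(2) g(2) irr vals'] show ?thesis
  proof (elim disjE exE conjE)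
    fix w assume w: "invertible w" "isom f g w"
    then have "A\<^sub>1 (int_vec u) = A\<^sub>2 (int_vec (u v* w)) \<and> B\<^sub>1 (int_vec u) = B\<^sub>2 (int_vec (u v* w))" for u
      by (intro cancel) (simp add: isom_def fu gu)
    then show ?thesis using w(1) unfolding isom_def by blast
  next
    fix k s c' d' w\<^sub>1 w\<^sub>2
    assume w: "invertible w\<^sub>1" "invertible w\<^sub>2" and tw: "twin k s c' d' f g w\<^sub>1 w\<^sub>2"
    then have f_tw: "f (int_vec u) = pencil k s c' d' (int_vec (u v* w\<^sub>1))"
      and g_tw: "g (int_vec u) = pencil k (\<not> s) c' d' (int_vec (u v* w\<^sub>2))" for u by (simp_all add: twin_def)
    \<comment> \<open>Evaluation at \<open>y\<close> and \<open>z\<close> writes the real coefficients as rational combinations of \<open>\<alpha>\<close> and \<open>\<beta>\<close>.\<close>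
    obtain w' where w': "\<And>u. (u v* w') v* w\<^sub>1 = u" by (rule invertible_vec_mult[OF w(1)], rule that)
    define y z where "y = norm_point s v* w'" and "z = line_point v* w'"
    define p p' where "p = A\<^sub>1 (int_vec y) / 3" and "p' = B\<^sub>1 (int_vec y) / 3"
    define q q' where "q = A\<^sub>1 (int_vec z) / line_weight k" and "q' = B\<^sub>1 (int_vec z) / line_weight k"
    have "3 * c' = f (int_vec y)" by (simp add: f_tw y_def w' pencil_norm_point)
    then have c': "c' = \<alpha> n * of_rat p + \<beta> n * of_rat p'"
      unfolding fu p_def p'_def by (simp add: of_rat_divide field_simps)
    have "line_weight k * d' = f (int_vec z)" by (simp add: f_tw z_def w' pencil_line_point)
    then have d': "d' = \<alpha> n * of_rat q + \<beta> n * of_rat q'"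
      unfolding fu q_def q'_def by (simp add: of_rat_divide field_simps line_weight_def split: if_splits)
    have split: "pencil k t c' d' (int_vec u) =
        \<alpha> n * of_rat (pencil k t p q (int_vec u)) + \<beta> n * of_rat (pencil k t p' q' (int_vec u))" for t u
      unfolding c' d' pencil_lincomb pencil_of_rat ..
    have "A\<^sub>1 (int_vec u) = pencil k s p q (int_vec (u v* w\<^sub>1)) \<and> B\<^sub>1 (int_vec u) = pencil k s p' q' (int_vec (u v* w\<^sub>1))" for u
      by (rule cancel) (metis fu f_tw split)
    moreover have "A\<^sub>2 (int_vec u) = pencil k (\<not> s) p q (int_vec (u v* w\<^sub>2)) \<and> B\<^sub>2 (int_vec u) = pencil k (\<not> s) p' q' (int_vec (u v* w\<^sub>2))" for u
      by (rule cancel) (metis gu g_tw split)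
    ultimately have "twin k s p q A\<^sub>1 A\<^sub>2 w\<^sub>1 w\<^sub>2 \<and> twin k s p' q' B\<^sub>1 B\<^sub>2 w\<^sub>1 w\<^sub>2" by (simp add: twin_def)
    then show ?thesis using w by blast
  qed
qed

section \<open>From pairs of rational forms to real forms\<close>

text \<open>Fix a functional \<open>\<phi>\<^sub>0\<close> for which \<open>\<phi>\<^sub>0 \<circ> f\<close> is definite. The rational assertion,
  applied to the pairs \<open>(\<phi>\<^sub>0 \<circ> f, \<phi> \<circ> f)\<close> and \<open>(\<phi>\<^sub>0 \<circ> g, \<phi> \<circ> g)\<close>, gives
  for each \<open>\<phi>\<close> one of three outcomes: the first pair is dependent, or one matrix \<open>w\<close>
  transforms the pairs into each other, or the pairs are exceptional. For fixed matrices every outcome defines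
  a subspace of functionals, and as \<open>\<phi>\<^sub>0 \<circ> f\<close> and \<open>\<phi>\<^sub>0 \<circ> g\<close> are definite, only finitely many
  matrices occur. So one outcome holds for all functionals at once, and because functionals separate reals it
  holds for \<open>f\<close> and \<open>g\<close> themselves.\<close>

theorem rational_to_real:
  fixes f g :: "real ^ 3 \<Rightarrow> real"
  assumes star: "\<And>A\<^sub>1 B\<^sub>1 A\<^sub>2 B\<^sub>2 :: rat ^ 3 \<Rightarrow> rat.
      A\<^sub>1 \<in> quad_forms UNIV \<Longrightarrow> B\<^sub>1 \<in> quad_forms UNIV \<Longrightarrow> A\<^sub>2 \<in> quad_forms UNIV \<Longrightarrow> B\<^sub>2 \<in> quad_forms UNIV \<Longrightarrow>
      lin_indep_forms A\<^sub>1 B\<^sub>1 \<Longrightarrow> lin_indep_forms A\<^sub>2 B\<^sub>2 \<Longrightarrow>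
      \<exists>c d. pos_definite (\<lambda>x. c * A\<^sub>1 x + d * B\<^sub>1 x) \<Longrightarrow> \<exists>c d. pos_definite (\<lambda>x. c * A\<^sub>2 x + d * B\<^sub>2 x) \<Longrightarrow>
      value_set \<int> (\<lambda>x. (A\<^sub>1 x, B\<^sub>1 x)) = value_set \<int> (\<lambda>x. (A\<^sub>2 x, B\<^sub>2 x)) \<Longrightarrow>
      (\<exists>w. invertible w \<and> isom A\<^sub>1 A\<^sub>2 w \<and> isom B\<^sub>1 B\<^sub>2 w) \<or>
      (\<exists>k s w\<^sub>1 w\<^sub>2 p q p' q'. invertible w\<^sub>1 \<and> invertible w\<^sub>2 \<and>
         twin k s p q A\<^sub>1 A\<^sub>2 w\<^sub>1 w\<^sub>2 \<and> twin k s p' q' B\<^sub>1 B\<^sub>2 w\<^sub>1 w\<^sub>2)"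
    and f: "f \<in> quad_forms UNIV" and g: "g \<in> quad_forms UNIV" and pd: "pos_definite f"
    and irr: "f \<notin> rational_multiples" and vals: "value_set \<int> f = value_set \<int> g"
  shows "(\<exists>w. invertible w \<and> isom f g w) \<or>
    (\<exists>k s c d w\<^sub>1 w\<^sub>2. invertible w\<^sub>1 \<and> invertible w\<^sub>2 \<and> twin k s c d f g w\<^sub>1 w\<^sub>2)"
proof -
  define image_of :: "(real \<Rightarrow> rat) \<Rightarrow> (real ^ 3 \<Rightarrow> real) \<Rightarrow> rat ^ 3 \<Rightarrow> rat" where
    "image_of \<phi> h = (SOME A. A \<in> quad_forms UNIV \<and> (\<forall>u. A (int_vec u) = \<phi> (h (int_vec u))))" for \<phi> h
  have "image_of \<phi> h \<in> quad_forms UNIV \<and> (\<forall>u. image_of \<phi> h (int_vec u) = \<phi> (h (int_vec u)))"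
    if "rat_linear \<phi>" "h \<in> quad_forms UNIV" for \<phi> h
  proof -
    have "\<exists>A. A \<in> quad_forms UNIV \<and> (\<forall>u. A (int_vec u) = \<phi> (h (int_vec u)))"
      by (rule rat_linear_form[OF that]) blast
    then show ?thesis unfolding image_of_def by (rule someI_ex)
  qed
  then have quad: "image_of \<phi> h \<in> quad_forms UNIV"
    and image_of: "image_of \<phi> h (int_vec u) = \<phi> (h (int_vec u))"
    if "rat_linear \<phi>" "h \<in> quad_forms UNIV" for \<phi> h u
    using that by blast+
  obtain \<Phi> :: "nat \<Rightarrow> real \<Rightarrow> rat" where \<Phi>: "\<And>n. rat_linear (\<Phi> n)" "\<And>r. (\<lambda>n. of_rat (\<Phi> n r)) \<longlonglongrightarrow> r"
    by (rule rat_linear_approximation, rule that)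
  have "\<exists>F. F \<in> quad_forms UNIV \<and> (\<forall>u. F (int_vec u) = real_of_rat (image_of (\<Phi> n) f (int_vec u)))" for n
    using quad_forms_mono[of \<rat> UNIV] by (rule_tac real_extension[OF quad[OF \<Phi>(1) f]]) blast
  then obtain F where F: "\<And>n. F n \<in> quad_forms UNIV"
    "\<And>n u. F n (int_vec u) = real_of_rat (image_of (\<Phi> n) f (int_vec u))" by metis
  have "eventually (\<lambda>n. pos_definite (F n)) sequentially"
    by (rule eventually_pos_definite[OF f F(1) pd]) (simp add: F(2) image_of[OF \<Phi>(1) f] \<Phi>(2))
  then obtain n where "pos_definite (F n)" by (auto simp: eventually_sequentially)
  then have pd_n: "pos_definite (image_of (\<Phi> n) f)"
    using pos_definite_real_extension[OF quad[OF \<Phi>(1) f] F] by simp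
  define \<phi>\<^sub>0 where "\<phi>\<^sub>0 = \<Phi> n"
  define A A' where "A = image_of \<phi>\<^sub>0 f" and "A' = image_of \<phi>\<^sub>0 g"
  have \<phi>0: "rat_linear \<phi>\<^sub>0" unfolding \<phi>\<^sub>0_def by (rule \<Phi>)
  have A: "A \<in> quad_forms UNIV" and A': "A' \<in> quad_forms UNIV"
    unfolding A_def A'_def using quad \<phi>0 f g by blast+
  have Au: "A (int_vec u) = \<phi>\<^sub>0 (f (int_vec u))" and A'u: "A' (int_vec u) = \<phi>\<^sub>0 (g (int_vec u))" for u
    unfolding A_def A'_def using image_of \<phi>0 f g by blast+
  have pdA: "pos_definite A" unfolding A_def \<phi>\<^sub>0_def by (rule pd_n)
  have pair_vals: "value_set \<int> (\<lambda>x. (A x, image_of \<phi> f x)) = value_set \<int> (\<lambda>x. (A' x, image_of \<phi> g x))"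
    if "rat_linear \<phi>" for \<phi>
    by (rule value_set_cong[OF vals, of _ "\<lambda>r. (\<phi>\<^sub>0 r, \<phi> r)"]) (simp_all add: Au A'u image_of that f g)
  have pdA': "pos_definite A'"
    using pos_definite_transfer[OF A quad[OF \<phi>0 f] A' quad[OF \<phi>0 g] pair_vals[OF \<phi>0], of 1 0] pdA by simp

  define T where "T = {\<phi>. rat_linear \<phi>}"
  define Rat_f where "Rat_f = {\<phi>. \<exists>q. \<forall>u. \<phi> (f (int_vec u)) = q * \<phi>\<^sub>0 (f (int_vec u))}"
  define Isom where "Isom w = {\<phi> :: real \<Rightarrow> rat. \<forall>u. \<phi> (f (int_vec u)) = \<phi> (g (int_vec (u v* w)))}" for w
  define Twin where "Twin k s w\<^sub>1 w\<^sub>2 = {\<phi> :: real \<Rightarrow> rat. \<exists>p q. \<forall>u.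
      \<phi> (f (int_vec u)) = pencil k s p q (int_vec (u v* w\<^sub>1)) \<and>
      \<phi> (g (int_vec u)) = pencil k (\<not> s) p q (int_vec (u v* w\<^sub>2))}" for k s w\<^sub>1 w\<^sub>2
  define W where "W = {w :: int ^ 3 ^ 3. \<forall>u. A (int_vec u) = A' (int_vec (u v* w))}"
  define P where "P B k s = {w. invertible w \<and> (\<exists>p q. \<forall>u. B (int_vec u) = pencil k s p q (int_vec (u v* w)))}"
    for B :: "rat ^ 3 \<Rightarrow> rat" and k s
  define \<F> where "\<F> = {Rat_f} \<union> Isom ` {w \<in> W. invertible w} \<union>
      (\<Union>k. \<Union>s. (\<lambda>(w\<^sub>1, w\<^sub>2). Twin k s w\<^sub>1 w\<^sub>2) ` (P A k s \<times> P A' k (\<not> s)))"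

  have "finite \<F>"
  proof -
    have "finite W" unfolding W_def by (rule finite_isometries[OF A' pdA'])
    moreover have "finite (P A k s)" "finite (P A' k s)" for k s
      unfolding P_def using finite_pencil_isometries A A' pdA pdA' by blast+
    ultimately show ?thesis unfolding \<F>_def by (intro finite_UnI finite_imageI finite_UN_I) auto
  qed
  moreover have "lin_closed S" if "S \<in> \<F>" for S
  proof -
    have "lin_closed Rat_f" unfolding lin_closed_def
    proof (intro ballI allI)
      fix \<phi> \<psi> t assume "\<phi> \<in> Rat_f" "\<psi> \<in> Rat_f"
      then obtain p q where "\<forall>u. \<phi> (f (int_vec u)) = p * \<phi>\<^sub>0 (f (int_vec u))"
        "\<forall>u. \<psi> (f (int_vec u)) = q * \<phi>\<^sub>0 (f (int_vec u))" unfolding Rat_f_def by blast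
      then show "(\<lambda>r. \<phi> r + t * \<psi> r) \<in> Rat_f"
        unfolding Rat_f_def by (intro CollectI exI[of _ "p + t * q"]) (simp add: algebra_simps)
    qed
    moreover have "lin_closed (Isom w)" for w
      unfolding lin_closed_def Isom_def by simp
    moreover have "lin_closed (Twin k s w\<^sub>1 w\<^sub>2)" for k s w\<^sub>1 w\<^sub>2
      unfolding lin_closed_def
    proof (intro ballI allI)
      fix \<phi> \<psi> t assume "\<phi> \<in> Twin k s w\<^sub>1 w\<^sub>2" "\<psi> \<in> Twin k s w\<^sub>1 w\<^sub>2"
      then obtain p q p' q' where
        "\<forall>u. \<phi> (f (int_vec u)) = pencil k s p q (int_vec (u v* w\<^sub>1)) \<and>
          \<phi> (g (int_vec u)) = pencil k (\<not> s) p q (int_vec (u v* w\<^sub>2))"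
        "\<forall>u. \<psi> (f (int_vec u)) = pencil k s p' q' (int_vec (u v* w\<^sub>1)) \<and>
          \<psi> (g (int_vec u)) = pencil k (\<not> s) p' q' (int_vec (u v* w\<^sub>2))" unfolding Twin_def by blast
      then show "(\<lambda>r. \<phi> r + t * \<psi> r) \<in> Twin k s w\<^sub>1 w\<^sub>2"
        unfolding Twin_def
        by (rule_tac CollectI, rule_tac exI[of _ "p + t * p'"], rule_tac exI[of _ "q + t * q'"])
          (simp add: pencil_lincomb[where \<alpha> = 1, unfolded mult_1])
    qed
    ultimately show ?thesis using that unfolding \<F>_def by auto
  qed
  moreover have "lin_closed T"
    unfolding lin_closed_def T_def rat_linear_def by (simp add: algebra_simps)
  moreover have "T \<noteq> {}" using \<phi>0 unfolding T_def by blast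
  moreover have "T \<subseteq> \<Union>\<F>"
  proof
    fix \<phi> assume "\<phi> \<in> T"
    then have \<phi>: "rat_linear \<phi>" by (simp add: T_def)
    define B B' where "B = image_of \<phi> f" and "B' = image_of \<phi> g"
    have B: "B \<in> quad_forms UNIV" and B': "B' \<in> quad_forms UNIV"
      unfolding B_def B'_def using quad \<phi> f g by blast+
    have Bu: "B (int_vec u) = \<phi> (f (int_vec u))" and B'u: "B' (int_vec u) = \<phi> (g (int_vec u))" for u
      unfolding B_def B'_def using image_of \<phi> f g by blast+
    have v: "value_set \<int> (\<lambda>x. (A x, B x)) = value_set \<int> (\<lambda>x. (A' x, B' x))"
      unfolding B_def B'_def by (rule pair_vals[OF \<phi>])
    show "\<phi> \<in> \<Union>\<F>"
    proof (cases "lin_indep_forms A B")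
      case False
      then obtain a b where ab: "\<And>x. a * A x + b * B x = 0" "a \<noteq> 0 \<or> b \<noteq> 0"
        unfolding lin_indep_forms_def by blast
      have "b \<noteq> 0" using ab(1)[of "pt 1 0 0"] ab(2) pos_definite_at_unit[OF pdA] by auto
      then have BA: "B x = (- a / b) * A x" for x using ab(1)[of x] by (simp add: field_simps add_eq_0_iff)
      have "\<phi> (f (int_vec u)) = (- a / b) * \<phi>\<^sub>0 (f (int_vec u))" for u
        unfolding Au[symmetric] Bu[symmetric] by (rule BA)
      then have "\<phi> \<in> Rat_f" unfolding Rat_f_def by blast
      moreover have "Rat_f \<in> \<F>" by (simp add: \<F>_def)
      ultimately show ?thesis by blast
    next
      case True
      have ind': "lin_indep_forms A' B'" using lin_indep_forms_transfer[OF A B A' B' v] True by blast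
      have p: "\<exists>c d. pos_definite (\<lambda>x. c * A x + d * B x)"
        using pdA by (intro exI[of _ 1] exI[of _ 0]) simp
      have p': "\<exists>c d. pos_definite (\<lambda>x. c * A' x + d * B' x)"
        using pdA' by (intro exI[of _ 1] exI[of _ 0]) simp
      show ?thesis
        using star[OF A B A' B' True ind' p p' v]
      proof (elim disjE exE conjE)
        fix w assume w: "invertible w" "isom A A' w" "isom B B' w"
        from w(2) have "w \<in> W" by (simp add: W_def isom_def)
        from w(3) have "\<phi> \<in> Isom w" by (simp add: Isom_def isom_def Bu B'u)
        moreover have "Isom w \<in> \<F>" using \<open>w \<in> W\<close> w(1) by (simp add: \<F>_def)
        ultimately show ?thesis by blast
      next
        fix k s w\<^sub>1 w\<^sub>2 p q p' q'
        assume w: "invertible w\<^sub>1" "invertible w\<^sub>2"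
          and tw: "twin k s p q A A' w\<^sub>1 w\<^sub>2" "twin k s p' q' B B' w\<^sub>1 w\<^sub>2"
        from tw(1) w have "w\<^sub>1 \<in> P A k s" "w\<^sub>2 \<in> P A' k (\<not> s)"
          unfolding P_def twin_def by blast+
        then have "Twin k s w\<^sub>1 w\<^sub>2 \<in> \<F>"
          unfolding \<F>_def by (intro UnI2 UN_I[of k] UN_I[of s] image_eqI[of _ _ "(w\<^sub>1, w\<^sub>2)"]) auto
        moreover from tw(2) have "\<phi> \<in> Twin k s w\<^sub>1 w\<^sub>2"
          unfolding Twin_def twin_def Bu B'u by blast
        ultimately show ?thesis by blast
      qed
    qed
  qed
  ultimately obtain S where S: "S \<in> \<F>" "T \<subseteq> S"
    using finite_cover_lin_closed[of \<F> T] by blast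
  from S(1) consider "S = Rat_f" | w where "invertible w" "S = Isom w"
    | k s w\<^sub>1 w\<^sub>2 where "invertible w\<^sub>1" "invertible w\<^sub>2" "S = Twin k s w\<^sub>1 w\<^sub>2"
    unfolding \<F>_def P_def by auto
  then show ?thesis
  proof cases
    case 1
    \<comment> \<open>All images of \<open>f\<close> are proportional to \<open>A\<close>, so \<open>f\<close> is proportional to the rational form \<open>A\<close>.\<close>
    define \<sigma> where "\<sigma> = A (pt 1 0 0)"
    define r where "r = f (pt 1 0 0) / of_rat \<sigma>"
    have \<sigma>: "\<sigma> > 0" unfolding \<sigma>_def by (rule pos_definite_at_unit[OF pdA])
    have r: "r > 0" unfolding r_def using \<sigma> pos_definite_at_unit[OF pd] by simp
    obtain h :: "real ^ 3 \<Rightarrow> real" where h: "h \<in> quad_forms \<rat>" "\<And>u. h (int_vec u) = of_rat (A (int_vec u))"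
      by (rule real_extension[OF A], rule that)
    have fA: "f (int_vec u) = of_rat (A (int_vec u) / \<sigma>) * f (pt 1 0 0)" for u
    proof (rule rat_linear_separate)
      fix \<phi> assume \<phi>: "rat_linear \<phi>"
      then have "\<phi> \<in> Rat_f" using S(2) 1 by (auto simp: T_def)
      then obtain q where "\<forall>u. \<phi> (f (int_vec u)) = q * \<phi>\<^sub>0 (f (int_vec u))"
        unfolding Rat_f_def by blast
      then have q: "\<phi> (f (int_vec u)) = q * A (int_vec u)" for u by (simp add: Au)
      show "\<phi> (f (int_vec u)) = \<phi> (of_rat (A (int_vec u) / \<sigma>) * f (pt 1 0 0))"
        unfolding rat_linear_scale[OF \<phi>] q using \<sigma> by (simp add: \<sigma>_def)
    qed
    have fh: "f (int_vec u) = r * h (int_vec u) + 0 * h (int_vec u)" for u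
      unfolding r_def h(2) fA[of u] by (simp add: of_rat_divide)
    have h': "h \<in> quad_forms UNIV" using quad_forms_mono[of \<rat> UNIV] h(1) by auto
    have "f = (\<lambda>x. r * h x + 0 * h x)"
      by (rule quad_forms_eqI[OF f quad_forms_lincomb[OF h' h']]) (rule fh)
    then have "f = (\<lambda>x. r * h x)" by (simp only: mult_zero_left add_0_right)
    moreover have "r \<noteq> 0" using r by simp
    ultimately have "f \<in> rational_multiples"
      using h(1) by (intro CollectI exI[of _ r] exI[of _ h] conjI)
    then show ?thesis using irr by contradiction
  next
    case 2
    have "f (int_vec u) = g (int_vec (u v* w))" for u
    proof (rule rat_linear_separate)
      fix \<phi> assume "rat_linear \<phi>"
      then have "\<phi> \<in> Isom w" using S(2) 2 by (auto simp: T_def)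
      then show "\<phi> (f (int_vec u)) = \<phi> (g (int_vec (u v* w)))" by (simp add: Isom_def)
    qed
    then show ?thesis using 2(1) unfolding isom_def by blast
  next
    case 3
    \<comment> \<open>The coefficients of the images of \<open>f\<close> are the images of values of \<open>f\<close>; these values, up to
      constants, are the real coefficients.\<close>
    obtain w' where w': "\<And>u. (u v* w') v* w\<^sub>1 = u" by (rule invertible_vec_mult[OF 3(1)], rule that)
    define c where "c = of_rat (1 / 3) * f (int_vec (norm_point s v* w'))"
    define d where "d = of_rat (1 / line_weight k) * f (int_vec (line_point v* w'))"
    have pq: "\<phi> (f (int_vec u)) = pencil k s (\<phi> c) (\<phi> d) (int_vec (u v* w\<^sub>1)) \<and>
        \<phi> (g (int_vec u)) = pencil k (\<not> s) (\<phi> c) (\<phi> d) (int_vec (u v* w\<^sub>2))" if \<phi>: "rat_linear \<phi>" for \<phi> u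
    proof -
      from \<phi> have "\<phi> \<in> Twin k s w\<^sub>1 w\<^sub>2" using S(2) 3 by (auto simp: T_def)
      then obtain p q where tw: "\<forall>u. \<phi> (f (int_vec u)) = pencil k s p q (int_vec (u v* w\<^sub>1)) \<and>
        \<phi> (g (int_vec u)) = pencil k (\<not> s) p q (int_vec (u v* w\<^sub>2))"
        unfolding Twin_def by blast
      have "\<phi> c = p" unfolding c_def rat_linear_scale[OF \<phi>] using tw by (simp add: w' pencil_norm_point)
      moreover have "\<phi> d = q" unfolding d_def rat_linear_scale[OF \<phi>]
        using tw by (simp add: w' pencil_line_point) (simp add: line_weight_def)
      ultimately show ?thesis using tw by simp
    qed
    have push: "\<phi> (pencil k t c d (int_vec u)) = pencil k t (\<phi> c) (\<phi> d) (int_vec u)" if \<phi>: "rat_linear \<phi>" for \<phi> t u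
    proof -
      have "pencil k t c d (int_vec u) =
          of_rat (norm_form t (int_vec u)) * c + of_rat ((line_form k t (int_vec u))\<^sup>2) * d"
        by (simp add: pencil_def norm_form_def line_form_def of_rat_add of_rat_diff of_rat_mult of_rat_power)
      then show ?thesis by (simp add: rat_linear_add[OF \<phi>] rat_linear_scale[OF \<phi>] pencil_def)
    qed
    have "f (int_vec u) = pencil k s c d (int_vec (u v* w\<^sub>1))" "g (int_vec u) = pencil k (\<not> s) c d (int_vec (u v* w\<^sub>2))" for u
      by (rule rat_linear_separate; simp add: push pq)+
    then have "twin k s c d f g w\<^sub>1 w\<^sub>2" by (simp add: twin_def)
    then show ?thesis using 3 by blast
  qed
qed

section \<open>The equivalence\<close>

lemma form_equiv_iff_isom:
  assumes f: "f \<in> quad_forms UNIV" and g: "g \<in> quad_forms UNIV"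
  shows "form_equiv f g \<longleftrightarrow> (\<exists>w. invertible w \<and> isom f g w)"
proof
  assume "form_equiv f g"
  then obtain w where w: "invertible w" "\<And>x. f (x v* map_matrix of_int w) = g x"
    unfolding form_equiv_def GL_int_def by blast
  obtain w' where w': "invertible w'" "\<And>u. (u v* w') v* w = u" by (rule invertible_vec_mult[OF w(1)], rule that)
  have "isom f g w'" unfolding isom_def by (simp flip: w(2) add: int_vec_mult w'(2))
  then show "\<exists>w. invertible w \<and> isom f g w" using w' by blast
next
  assume "\<exists>w. invertible w \<and> isom f g w"
  then obtain w where w: "invertible w" "isom f g w" by blast
  obtain w' where w': "invertible w'" "\<And>u. (u v* w') v* w = u" by (rule invertible_vec_mult[OF w(1)], rule that)
  have "(\<lambda>x. f (x v* map_matrix of_int w')) = g"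
    by (rule quad_forms_eqI[OF quad_forms_compose[OF f] g])
       (use w(2) in \<open>simp add: int_vec_mult isom_def w'(2)\<close>)
  then show "form_equiv f g" unfolding form_equiv_def GL_int_def using w'(1) by (auto simp: fun_eq_iff)
qed

lemma twin_iff_form_equiv:
  assumes "f \<in> quad_forms UNIV" "g \<in> quad_forms UNIV"
  shows "(\<exists>w\<^sub>1 w\<^sub>2. invertible w\<^sub>1 \<and> invertible w\<^sub>2 \<and> twin k s c d f g w\<^sub>1 w\<^sub>2) \<longleftrightarrow>
    form_equiv f (pencil k s c d) \<and> form_equiv g (pencil k (\<not> s) c d)"
  unfolding form_equiv_iff_isom[OF assms(1) pencil_quad] form_equiv_iff_isom[OF assms(2) pencil_quad]
  unfolding twin_def isom_def by blast

definition line_square :: "bool \<Rightarrow> bool \<Rightarrow> 'a::field ^ 3 \<Rightarrow> 'a" where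
  "line_square k s x = (line_form k s x)\<^sup>2"

lemma pair_act_isom:
  assumes "A \<in> quad_forms UNIV" "B \<in> quad_forms UNIV" "A' \<in> quad_forms UNIV" "B' \<in> quad_forms UNIV"
  shows "(A, B) = pair_act (map_matrix of_int w) (mat 1) (A', B') \<longleftrightarrow> isom A A' w \<and> isom B B' w"
proof -
  have "(A, B) = pair_act (map_matrix of_int w) (mat 1) (A', B') \<longleftrightarrow>
      A = (\<lambda>x. A' (x v* map_matrix of_int w)) \<and> B = (\<lambda>x. B' (x v* map_matrix of_int w))"
    by (simp add: mat_def)
  also have "\<dots> \<longleftrightarrow> isom A A' w \<and> isom B B' w"
    unfolding isom_def using quad_forms_eqI[OF assms(1) quad_forms_compose[OF assms(3)]]
      quad_forms_eqI[OF assms(2) quad_forms_compose[OF assms(4)]]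
    by (auto simp: int_vec_mult)
  finally show ?thesis .
qed

lemma pair_act_mat_1_iff_isom:
  assumes "A \<in> quad_forms UNIV" "B \<in> quad_forms UNIV" "A' \<in> quad_forms UNIV" "B' \<in> quad_forms UNIV"
  shows "(\<exists>w\<in>GL_int. (A, B) = pair_act w (mat 1) (A', B')) \<longleftrightarrow> (\<exists>w. invertible w \<and> isom A A' w \<and> isom B B' w)"
  unfolding pair_act_isom[OF assms, symmetric] GL_int_def by blast

lemma pair_act_pencil:
  fixes A B :: "rat ^ 3 \<Rightarrow> rat"
  assumes "A \<in> quad_forms UNIV" "B \<in> quad_forms UNIV"
  shows "(A, B) = pair_act (map_matrix of_int w) v (norm_form s, line_square k s) \<longleftrightarrow>
    isom A (pencil k s (v$1$1) (v$1$2)) w \<and> isom B (pencil k s (v$2$1) (v$2$2)) w"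
proof -
  have "(A, B) = pair_act (map_matrix of_int w) v (norm_form s, line_square k s) \<longleftrightarrow>
      (A, B) = pair_act (map_matrix of_int w) (mat 1) (pencil k s (v$1$1) (v$1$2), pencil k s (v$2$1) (v$2$2))"
    by (simp add: mat_def pencil_def line_square_def)
  then show ?thesis using pair_act_isom[OF assms pencil_quad pencil_quad] by simp
qed

text \<open>A relation between the rows of a singular coefficient matrix would be a relation between \<open>A\<close>
  and \<open>B\<close>.\<close>

lemma independent_pencils_invertible:
  fixes A B :: "rat ^ 3 \<Rightarrow> rat"
  assumes "A \<in> quad_forms UNIV" "B \<in> quad_forms UNIV" and ind: "lin_indep_forms A B"
    and "isom A (pencil k s p q) w" "isom B (pencil k s p' q') w"
  shows "p * q' - q * p' \<noteq> 0"
proof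
  assume det: "p * q' - q * p' = 0"
  have null: "a = 0 \<and> b = 0" if "a * p + b * p' = 0" "a * q + b * q' = 0" for a b
  proof -
    have "a * A (int_vec u) + b * B (int_vec u) = 0" for u
    proof -
      have "a * A (int_vec u) + b * B (int_vec u) =
          pencil k s (a * p + b * p') (a * q + b * q') (int_vec (u v* w))"
        unfolding pencil_lincomb using assms(4,5) by (simp add: isom_def)
      then show ?thesis by (simp add: that pencil_def)
    qed
    then show ?thesis using ind unfolding lin_indep_forms_iff_values[OF assms(1,2)] by blast
  qed
  have "p' = 0" "p = 0" using null[of p' "- p"] det by (auto simp: algebra_simps)
  moreover have "q' = 0" "q = 0" using null[of q' "- q"] det by (auto simp: algebra_simps)
  ultimately show False using null[of 1 1] by simp
qed

lemma twin_iff_pair_act: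
  fixes A\<^sub>1 B\<^sub>1 A\<^sub>2 B\<^sub>2 :: "rat ^ 3 \<Rightarrow> rat"
  assumes A1: "A\<^sub>1 \<in> quad_forms UNIV" and B1: "B\<^sub>1 \<in> quad_forms UNIV"
    and A2: "A\<^sub>2 \<in> quad_forms UNIV" and B2: "B\<^sub>2 \<in> quad_forms UNIV"
    and ind: "lin_indep_forms A\<^sub>1 B\<^sub>1"
  shows "(\<exists>w\<^sub>1 w\<^sub>2 p q p' q'. invertible w\<^sub>1 \<and> invertible w\<^sub>2 \<and>
       twin k s p q A\<^sub>1 A\<^sub>2 w\<^sub>1 w\<^sub>2 \<and> twin k s p' q' B\<^sub>1 B\<^sub>2 w\<^sub>1 w\<^sub>2) \<longleftrightarrow>
    (\<exists>w\<^sub>1\<in>GL_int. \<exists>w\<^sub>2\<in>GL_int. \<exists>v :: rat ^ 2 ^ 2. invertible v \<and>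
       (A\<^sub>1, B\<^sub>1) = pair_act w\<^sub>1 v (norm_form s, line_square k s) \<and>
       (A\<^sub>2, B\<^sub>2) = pair_act w\<^sub>2 v (norm_form (\<not> s), line_square k (\<not> s)))" (is "?L = ?R")
proof
  assume ?L
  then obtain w\<^sub>1 w\<^sub>2 p q p' q' where w: "invertible w\<^sub>1" "invertible w\<^sub>2"
    and 1: "isom A\<^sub>1 (pencil k s p q) w\<^sub>1" "isom B\<^sub>1 (pencil k s p' q') w\<^sub>1"
    and 2: "isom A\<^sub>2 (pencil k (\<not> s) p q) w\<^sub>2" "isom B\<^sub>2 (pencil k (\<not> s) p' q') w\<^sub>2"
    unfolding twin_def isom_def by blast
  define v :: "rat ^ 2 ^ 2" where "v = vector [vector [p, q], vector [p', q']]"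
  have "invertible v"
    using independent_pencils_invertible[OF A1 B1 ind 1]
    unfolding invertible_det_nz det_2 by (simp add: v_def)
  moreover have "(A\<^sub>1, B\<^sub>1) = pair_act (map_matrix of_int w\<^sub>1) v (norm_form s, line_square k s)"
    unfolding pair_act_pencil[OF A1 B1] using 1 by (simp add: v_def)
  moreover have "(A\<^sub>2, B\<^sub>2) = pair_act (map_matrix of_int w\<^sub>2) v (norm_form (\<not> s), line_square k (\<not> s))"
    unfolding pair_act_pencil[OF A2 B2] using 2 by (simp add: v_def)
  ultimately show ?R using w unfolding GL_int_def by blast
next
  assume ?R
  then obtain w\<^sub>1 w\<^sub>2 v where w: "invertible w\<^sub>1" "invertible w\<^sub>2"
    and "(A\<^sub>1, B\<^sub>1) = pair_act (map_matrix of_int w\<^sub>1) v (norm_form s, line_square k s)"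
     "(A\<^sub>2, B\<^sub>2) = pair_act (map_matrix of_int w\<^sub>2) v (norm_form (\<not> s), line_square k (\<not> s))"
    unfolding GL_int_def by blast
  then have "twin k s (v$1$1) (v$1$2) A\<^sub>1 A\<^sub>2 w\<^sub>1 w\<^sub>2 \<and> twin k s (v$2$1) (v$2$2) B\<^sub>1 B\<^sub>2 w\<^sub>1 w\<^sub>2"
    unfolding pair_act_pencil[OF A1 B1] pair_act_pencil[OF A2 B2] twin_def isom_def by blast
  then show ?L using w by blast
qed

lemma pencil_real_cases:
  "(\<exists>c d. unordered_pair_equiv f g
           (\<lambda>x. c * ((x$1)^2 - x$1 * x$2 + (x$2)^2) + d * (x$3)^2)
           (\<lambda>x. c * ((x$1)^2 + 3 * (x$2)^2) + d * (x$3)^2) \<or>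
         unordered_pair_equiv f g
           (\<lambda>x. c * ((x$1)^2 - x$1 * x$2 + (x$2)^2) + d * (x$1 + x$2 + 3 * x$3)^2)
           (\<lambda>x. c * ((x$1)^2 + 3 * (x$2)^2) + d * (x$1 + 3 * x$3)^2)) \<longleftrightarrow>
   (\<exists>k s c d. form_equiv f (pencil k s c d) \<and> form_equiv g (pencil k (\<not> s) c d))"
  unfolding unordered_pair_equiv_def
  by (simp add: ex_bool_eq pencil_def[abs_def] norm_form_def line_form_def) blast

lemma pencil_rat_cases:
  fixes A\<^sub>1 B\<^sub>1 A\<^sub>2 B\<^sub>2 :: "rat ^ 3 \<Rightarrow> rat"
  shows "(\<exists>w\<^sub>1\<in>GL_int. \<exists>w\<^sub>2\<in>GL_int. \<exists>v :: rat ^ 2 ^ 2. invertible v \<and>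
         ({(A\<^sub>1, B\<^sub>1), (A\<^sub>2, B\<^sub>2)} =
            {pair_act w\<^sub>1 v (\<lambda>x. (x$1)^2 - x$1 * x$2 + (x$2)^2, \<lambda>x. (x$3)^2),
             pair_act w\<^sub>2 v (\<lambda>x. (x$1)^2 + 3 * (x$2)^2, \<lambda>x. (x$3)^2)} \<or>
          {(A\<^sub>1, B\<^sub>1), (A\<^sub>2, B\<^sub>2)} =
            {pair_act w\<^sub>1 v (\<lambda>x. (x$1)^2 - x$1 * x$2 + (x$2)^2,
                           \<lambda>x. (x$1 + x$2 + 3 * x$3)^2),
             pair_act w\<^sub>2 v (\<lambda>x. (x$1)^2 + 3 * (x$2)^2,
                           \<lambda>x. (x$1 + 3 * x$3)^2)})) \<longleftrightarrow>
    (\<exists>k s. \<exists>w\<^sub>1\<in>GL_int. \<exists>w\<^sub>2\<in>GL_int. \<exists>v :: rat ^ 2 ^ 2. invertible v \<and>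
       (A\<^sub>1, B\<^sub>1) = pair_act w\<^sub>1 v (norm_form s, line_square k s) \<and>
       (A\<^sub>2, B\<^sub>2) = pair_act w\<^sub>2 v (norm_form (\<not> s), line_square k (\<not> s)))"
proof -
  have forms: "(\<lambda>x. (x$1)^2 - x$1 * x$2 + (x$2)^2 :: rat) = norm_form False"
    "(\<lambda>x. (x$1)^2 + 3 * (x$2)^2 :: rat) = norm_form True"
    "(\<lambda>x. (x$1 + x$2 + 3 * x$3)^2 :: rat) = line_square True False"
    "(\<lambda>x. (x$1 + 3 * x$3)^2 :: rat) = line_square True True"
    and axis: "(\<lambda>x. (x$3)^2 :: rat) = line_square False False" "line_square False True = line_square False False"
    by (simp_all add: fun_eq_iff norm_form_def line_square_def line_form_def)
  show ?thesis
    unfolding forms axis doubleton_eq_iff ex_bool_eq not_True_eq_False not_False_eq_True by blast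
qed
theorem proposition1p1:
  shows
  "(\<forall>f g :: real ^ 3 \<Rightarrow> real.
      f \<in> quad_forms UNIV \<and> g \<in> quad_forms UNIV \<and> pos_definite f \<and> pos_definite g \<and>
      f \<notin> {\<lambda>x. r * h x | r h. r \<noteq> 0 \<and> h \<in> quad_forms \<rat>} \<and>
      \<not> form_equiv f g \<and>
      value_set \<int> f = value_set \<int> g
      \<longrightarrow> (\<exists>c d :: real.
         unordered_pair_equiv f g
           (\<lambda>x. c * ((x$1)^2 - x$1 * x$2 + (x$2)^2) + d * (x$3)^2)
           (\<lambda>x. c * ((x$1)^2 + 3 * (x$2)^2) + d * (x$3)^2) \<or>
         unordered_pair_equiv f g
           (\<lambda>x. c * ((x$1)^2 - x$1 * x$2 + (x$2)^2) + d * (x$1 + x$2 + 3 * x$3)^2)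
           (\<lambda>x. c * ((x$1)^2 + 3 * (x$2)^2) + d * (x$1 + 3 * x$3)^2)))
   \<longleftrightarrow>
   (\<forall>A\<^sub>1 B\<^sub>1 A\<^sub>2 B\<^sub>2 :: rat ^ 3 \<Rightarrow> rat.
      A\<^sub>1 \<in> quad_forms UNIV \<and> B\<^sub>1 \<in> quad_forms UNIV \<and>
      A\<^sub>2 \<in> quad_forms UNIV \<and> B\<^sub>2 \<in> quad_forms UNIV \<and>
      lin_indep_forms A\<^sub>1 B\<^sub>1 \<and> lin_indep_forms A\<^sub>2 B\<^sub>2 \<and>
      (\<exists>c d :: rat. pos_definite (\<lambda>x. c * A\<^sub>1 x + d * B\<^sub>1 x)) \<and>
      (\<exists>c d :: rat. pos_definite (\<lambda>x. c * A\<^sub>2 x + d * B\<^sub>2 x)) \<and>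
      value_set \<int> (\<lambda>x. (A\<^sub>1 x, B\<^sub>1 x)) = value_set \<int> (\<lambda>x. (A\<^sub>2 x, B\<^sub>2 x))
      \<longrightarrow>
      (\<exists>w\<in>GL_int. (A\<^sub>1, B\<^sub>1) = pair_act w (mat 1) (A\<^sub>2, B\<^sub>2)) \<or>
      (\<exists>w\<^sub>1\<in>GL_int. \<exists>w\<^sub>2\<in>GL_int. \<exists>v :: rat ^ 2 ^ 2. invertible v \<and>
         ({(A\<^sub>1, B\<^sub>1), (A\<^sub>2, B\<^sub>2)} =
            {pair_act w\<^sub>1 v (\<lambda>x. (x$1)^2 - x$1 * x$2 + (x$2)^2, \<lambda>x. (x$3)^2),
             pair_act w\<^sub>2 v (\<lambda>x. (x$1)^2 + 3 * (x$2)^2, \<lambda>x. (x$3)^2)} \<or>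
          {(A\<^sub>1, B\<^sub>1), (A\<^sub>2, B\<^sub>2)} =
            {pair_act w\<^sub>1 v (\<lambda>x. (x$1)^2 - x$1 * x$2 + (x$2)^2,
                           \<lambda>x. (x$1 + x$2 + 3 * x$3)^2),
             pair_act w\<^sub>2 v (\<lambda>x. (x$1)^2 + 3 * (x$2)^2,
                           \<lambda>x. (x$1 + 3 * x$3)^2)})))"
  unfolding pencil_real_cases pencil_rat_cases
proof (rule iffI)
  assume K: "\<forall>f g :: real ^ 3 \<Rightarrow> real.
      f \<in> quad_forms UNIV \<and> g \<in> quad_forms UNIV \<and> pos_definite f \<and> pos_definite g \<and>
      f \<notin> rational_multiples \<and> \<not> form_equiv f g \<and> value_set \<int> f = value_set \<int> g \<longrightarrow>
      (\<exists>k s c d. form_equiv f (pencil k s c d) \<and> form_equiv g (pencil k (\<not> s) c d))"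
  have K': "(\<exists>w. invertible w \<and> isom f g w) \<or>
      (\<exists>k s c d w\<^sub>1 w\<^sub>2. invertible w\<^sub>1 \<and> invertible w\<^sub>2 \<and> twin k s c d f g w\<^sub>1 w\<^sub>2)"
    if "f \<in> quad_forms UNIV" "g \<in> quad_forms UNIV" "pos_definite f" "pos_definite g"
      "f \<notin> rational_multiples" "value_set \<int> f = value_set \<int> g" for f g :: "real ^ 3 \<Rightarrow> real"
    unfolding form_equiv_iff_isom[OF that(1,2), symmetric] twin_iff_form_equiv[OF that(1,2)]
    using K that by blast
  show "\<forall>A\<^sub>1 B\<^sub>1 A\<^sub>2 B\<^sub>2 :: rat ^ 3 \<Rightarrow> rat.
      A\<^sub>1 \<in> quad_forms UNIV \<and> B\<^sub>1 \<in> quad_forms UNIV \<and> A\<^sub>2 \<in> quad_forms UNIV \<and> B\<^sub>2 \<in> quad_forms UNIV \<and>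
      lin_indep_forms A\<^sub>1 B\<^sub>1 \<and> lin_indep_forms A\<^sub>2 B\<^sub>2 \<and>
      (\<exists>c d :: rat. pos_definite (\<lambda>x. c * A\<^sub>1 x + d * B\<^sub>1 x)) \<and>
      (\<exists>c d :: rat. pos_definite (\<lambda>x. c * A\<^sub>2 x + d * B\<^sub>2 x)) \<and>
      value_set \<int> (\<lambda>x. (A\<^sub>1 x, B\<^sub>1 x)) = value_set \<int> (\<lambda>x. (A\<^sub>2 x, B\<^sub>2 x)) \<longrightarrow>
      (\<exists>w\<in>GL_int. (A\<^sub>1, B\<^sub>1) = pair_act w (mat 1) (A\<^sub>2, B\<^sub>2)) \<or>
      (\<exists>k s. \<exists>w\<^sub>1\<in>GL_int. \<exists>w\<^sub>2\<in>GL_int. \<exists>v :: rat ^ 2 ^ 2. invertible v \<and>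
         (A\<^sub>1, B\<^sub>1) = pair_act w\<^sub>1 v (norm_form s, line_square k s) \<and>
         (A\<^sub>2, B\<^sub>2) = pair_act w\<^sub>2 v (norm_form (\<not> s), line_square k (\<not> s)))"
  proof (intro allI impI, elim conjE exE)
    fix A\<^sub>1 B\<^sub>1 A\<^sub>2 B\<^sub>2 :: "rat ^ 3 \<Rightarrow> rat" and c d
    assume A1: "A\<^sub>1 \<in> quad_forms UNIV" and B1: "B\<^sub>1 \<in> quad_forms UNIV"
      and A2: "A\<^sub>2 \<in> quad_forms UNIV" and B2: "B\<^sub>2 \<in> quad_forms UNIV"
      and ind: "lin_indep_forms A\<^sub>1 B\<^sub>1" and pd: "pos_definite (\<lambda>x. c * A\<^sub>1 x + d * B\<^sub>1 x)"
      and vals: "value_set \<int> (\<lambda>x. (A\<^sub>1 x, B\<^sub>1 x)) = value_set \<int> (\<lambda>x. (A\<^sub>2 x, B\<^sub>2 x))"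
    from real_to_rational[OF K' A1 B1 A2 B2 ind pd vals]
    show "(\<exists>w\<in>GL_int. (A\<^sub>1, B\<^sub>1) = pair_act w (mat 1) (A\<^sub>2, B\<^sub>2)) \<or>
      (\<exists>k s. \<exists>w\<^sub>1\<in>GL_int. \<exists>w\<^sub>2\<in>GL_int. \<exists>v :: rat ^ 2 ^ 2. invertible v \<and>
         (A\<^sub>1, B\<^sub>1) = pair_act w\<^sub>1 v (norm_form s, line_square k s) \<and>
         (A\<^sub>2, B\<^sub>2) = pair_act w\<^sub>2 v (norm_form (\<not> s), line_square k (\<not> s)))"
      unfolding twin_iff_pair_act[OF A1 B1 A2 B2 ind] pair_act_mat_1_iff_isom[OF A1 B1 A2 B2] .
  qed
next
  assume S: "\<forall>A\<^sub>1 B\<^sub>1 A\<^sub>2 B\<^sub>2 :: rat ^ 3 \<Rightarrow> rat.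
      A\<^sub>1 \<in> quad_forms UNIV \<and> B\<^sub>1 \<in> quad_forms UNIV \<and> A\<^sub>2 \<in> quad_forms UNIV \<and> B\<^sub>2 \<in> quad_forms UNIV \<and>
      lin_indep_forms A\<^sub>1 B\<^sub>1 \<and> lin_indep_forms A\<^sub>2 B\<^sub>2 \<and>
      (\<exists>c d :: rat. pos_definite (\<lambda>x. c * A\<^sub>1 x + d * B\<^sub>1 x)) \<and>
      (\<exists>c d :: rat. pos_definite (\<lambda>x. c * A\<^sub>2 x + d * B\<^sub>2 x)) \<and>
      value_set \<int> (\<lambda>x. (A\<^sub>1 x, B\<^sub>1 x)) = value_set \<int> (\<lambda>x. (A\<^sub>2 x, B\<^sub>2 x)) \<longrightarrow>
      (\<exists>w\<in>GL_int. (A\<^sub>1, B\<^sub>1) = pair_act w (mat 1) (A\<^sub>2, B\<^sub>2)) \<or>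
      (\<exists>k s. \<exists>w\<^sub>1\<in>GL_int. \<exists>w\<^sub>2\<in>GL_int. \<exists>v :: rat ^ 2 ^ 2. invertible v \<and>
         (A\<^sub>1, B\<^sub>1) = pair_act w\<^sub>1 v (norm_form s, line_square k s) \<and>
         (A\<^sub>2, B\<^sub>2) = pair_act w\<^sub>2 v (norm_form (\<not> s), line_square k (\<not> s)))"
  have S': "(\<exists>w. invertible w \<and> isom A\<^sub>1 A\<^sub>2 w \<and> isom B\<^sub>1 B\<^sub>2 w) \<or>
      (\<exists>k s w\<^sub>1 w\<^sub>2 p q p' q'. invertible w\<^sub>1 \<and> invertible w\<^sub>2 \<and>
         twin k s p q A\<^sub>1 A\<^sub>2 w\<^sub>1 w\<^sub>2 \<and> twin k s p' q' B\<^sub>1 B\<^sub>2 w\<^sub>1 w\<^sub>2)"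
    if "A\<^sub>1 \<in> quad_forms UNIV" "B\<^sub>1 \<in> quad_forms UNIV" "A\<^sub>2 \<in> quad_forms UNIV" "B\<^sub>2 \<in> quad_forms UNIV"
      "lin_indep_forms A\<^sub>1 B\<^sub>1" "lin_indep_forms A\<^sub>2 B\<^sub>2"
      "\<exists>c d. pos_definite (\<lambda>x. c * A\<^sub>1 x + d * B\<^sub>1 x)" "\<exists>c d. pos_definite (\<lambda>x. c * A\<^sub>2 x + d * B\<^sub>2 x)"
      "value_set \<int> (\<lambda>x. (A\<^sub>1 x, B\<^sub>1 x)) = value_set \<int> (\<lambda>x. (A\<^sub>2 x, B\<^sub>2 x))"
    for A\<^sub>1 B\<^sub>1 A\<^sub>2 B\<^sub>2 :: "rat ^ 3 \<Rightarrow> rat"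
    unfolding twin_iff_pair_act[OF that(1-5)] pair_act_mat_1_iff_isom[OF that(1-4), symmetric]
    by (intro S[rule_format] conjI that)
  show "\<forall>f g :: real ^ 3 \<Rightarrow> real.
      f \<in> quad_forms UNIV \<and> g \<in> quad_forms UNIV \<and> pos_definite f \<and> pos_definite g \<and>
      f \<notin> rational_multiples \<and> \<not> form_equiv f g \<and> value_set \<int> f = value_set \<int> g \<longrightarrow>
      (\<exists>k s c d. form_equiv f (pencil k s c d) \<and> form_equiv g (pencil k (\<not> s) c d))"
  proof (intro allI impI, elim conjE)
    fix f g :: "real ^ 3 \<Rightarrow> real"
    assume f: "f \<in> quad_forms UNIV" and g: "g \<in> quad_forms UNIV" and pd: "pos_definite f"
      and irr: "f \<notin> rational_multiples" and ne: "\<not> form_equiv f g" and vals: "value_set \<int> f = value_set \<int> g"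
    from rational_to_real[OF S' f g pd irr vals] ne
    show "\<exists>k s c d. form_equiv f (pencil k s c d) \<and> form_equiv g (pencil k (\<not> s) c d)"
      unfolding form_equiv_iff_isom[OF f g] twin_iff_form_equiv[OF f g] by blast
  qed
qed

end
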